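(* Let $\Sigma$ be a complete properly immersed self-expander hypersurface in $\mathbb{R}^{n+1}$. Assume that its mean curvature $H$ satisfies $|H|(x)\le a|x|+b$ for all $x\in\Sigma$, for some constants $0\le a<\frac12$ and $b>0$. If there exists $\beta>0$ such that $$|A|^2H^2+\tfrac12H^2+\beta A(x^T,x^T)H\le0\quad\text{on }\Sigma,$$ then $\Sigma$ must be a hyperplane $\mathbb{R}^n$ through the origin.
   Context: $x$ denotes the position vector, $x^T$ and $x^\perp$ its tangent and normal components along the (connected) immersed hypersurface $\Sigma$. The second fundamental form is $A(X,Y)=(\overline\nabla_XY)^\perp$ ($\overline\nabla$ the Euclidean connection) and the mean curvature vector $\mathbf{H}$ is the trace of $A$. $\Sigma$ is a self-expander if $\mathbf{H}=\frac12x^\perp$. With $\mathbf{n}$ the unit normal field, the mean curvature $H$ is defined by $\mathbf{H}=-H\mathbf{n}$, so that $H=-\frac12\langle x,\mathbf{n}\rangle$; the scalar $A(x^T,x^T)$ means $\langle A(x^T,x^T),\mathbf{n}\rangle$, with the same $\mathbf{n}$. (The product $A(x^T,x^T)H$ does not depend on the choice of $\mathbf{n}$.) $\Sigma$ is properly immersed if the preimage under the immersion of every compact subset of $\mathbb{R}^{n+1}$ is compact. *)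

theory Defs
  imports "HOL-Analysis.Analysis"
begin

text \<open>
  Conventions. The hypersurface is an abstract smooth manifold: a subset \<open>M\<close> of a Hausdorff,
  second countable space with a smooth atlas \<open>\<A>\<close> modelled on a Euclidean space \<open>'m\<close>, together
  with an immersion \<open>F\<close> into a Euclidean space \<open>'a\<close> of one dimension more. The position vector at
  \<open>p\<close> is \<open>F p\<close>, and tangent vectors are identified with their images in \<open>'a\<close>.
  Pointwise quantities are computed in a chart \<open>c\<close> around \<open>p\<close>; they do not depend on the choice of
  the chart.
\<close>

section \<open>Smooth manifolds and immersions\<close>

text \<open>For open \<open>S\<close> in a finite-dimensional space this is the class $C^k$: all iterated
  directional derivatives of order at most $k$ exist and are continuous.\<close>

fun Ck_on :: "nat \<Rightarrow> 'a::real_normed_vector set \<Rightarrow> ('a \<Rightarrow> 'b::real_normed_vector) \<Rightarrow> bool" where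
  "Ck_on 0 S f \<longleftrightarrow> continuous_on S f"
| "Ck_on (Suc k) S f \<longleftrightarrow>
     (\<forall>x\<in>S. f differentiable (at x)) \<and> (\<forall>v. Ck_on k S (\<lambda>x. frechet_derivative f (at x) v))"

definition smooth_on :: "'a::real_normed_vector set \<Rightarrow> ('a \<Rightarrow> 'b::real_normed_vector) \<Rightarrow> bool" where
  "smooth_on S f \<longleftrightarrow> (\<forall>k. Ck_on k S f)"

type_synonym ('p, 'm) chart = "'p set \<times> ('p \<Rightarrow> 'm)"

definition param :: "('p, 'm) chart \<Rightarrow> 'm \<Rightarrow> 'p" where
  "param c = inv_into (fst c) (snd c)"

definition is_chart ::
    "'p::topological_space set \<Rightarrow> ('p, 'm::euclidean_space) chart \<Rightarrow> bool" where
  "is_chart M c \<longleftrightarrow>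
     openin (top_of_set M) (fst c) \<and> open (snd c ` fst c) \<and>
     homeomorphism (fst c) (snd c ` fst c) (snd c) (param c)"

definition smooth_atlas ::
    "'p::topological_space set \<Rightarrow> ('p, 'm::euclidean_space) chart set \<Rightarrow> bool" where
  "smooth_atlas M \<A> \<longleftrightarrow>
     (\<forall>c\<in>\<A>. is_chart M c) \<and> (\<Union>c\<in>\<A>. fst c) = M \<and>
     (\<forall>c\<in>\<A>. \<forall>d\<in>\<A>. smooth_on (snd c ` (fst c \<inter> fst d)) (snd d \<circ> param c))"

text \<open>If \<open>Y\<close> is a vector-valued function on the manifold and \<open>v\<close> are the coordinates of a tangent
  vector \<open>X\<close> at \<open>p\<close>, this is the Euclidean directional derivative $\overline\nabla_X Y$ at \<open>p\<close>.
  For \<open>Y = F\<close> it is the differential of the immersion.\<close>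

definition dir_deriv ::
    "('p, 'm::euclidean_space) chart \<Rightarrow> ('p \<Rightarrow> 'a::euclidean_space) \<Rightarrow> 'p \<Rightarrow> 'm \<Rightarrow> 'a" where
  "dir_deriv c Y p v = frechet_derivative (Y \<circ> param c) (at (snd c p)) v"

definition smooth_immersion ::
    "('p, 'm::euclidean_space) chart set \<Rightarrow> ('p \<Rightarrow> 'a::euclidean_space) \<Rightarrow> bool" where
  "smooth_immersion \<A> F \<longleftrightarrow>
     (\<forall>c\<in>\<A>. smooth_on (snd c ` fst c) (F \<circ> param c) \<and> (\<forall>p\<in>fst c. inj (dir_deriv c F p)))"

definition immersed_hypersurface ::
    "'p::{t2_space, second_countable_topology} set \<Rightarrow> ('p, 'm::euclidean_space) chart set \<Rightarrow>
     ('p \<Rightarrow> 'a::euclidean_space) \<Rightarrow> bool" where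
  "immersed_hypersurface M \<A> F \<longleftrightarrow>
     DIM('a) = DIM('m) + 1 \<and> M \<noteq> {} \<and> connected M \<and> smooth_atlas M \<A> \<and> smooth_immersion \<A> F"

definition properly_immersed ::
    "'p::topological_space set \<Rightarrow> ('p \<Rightarrow> 'a::euclidean_space) \<Rightarrow> bool" where
  "properly_immersed M F \<longleftrightarrow> (\<forall>K. compact K \<longrightarrow> compact {p \<in> M. F p \<in> K})"

section \<open>The induced distance\<close>

text \<open>Since \<open>F\<close> is an immersion, a continuous curve \<open>\<gamma>\<close> in \<open>M\<close> is $C^1$ near a parameter iff
  \<open>F \<circ> \<gamma>\<close> is. As \<open>piecewise_C1_differentiable_on\<close> allows the derivative to be unbounded at
  the finitely many exceptional parameters, integrability of the speed is required through
  \<open>has_integral\<close>.\<close>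

definition induced_dist ::
    "'p::topological_space set \<Rightarrow> ('p \<Rightarrow> 'a::euclidean_space) \<Rightarrow> 'p \<Rightarrow> 'p \<Rightarrow> real" where
  "induced_dist M F p q =
     Inf {l. \<exists>\<gamma>. path \<gamma> \<and> path_image \<gamma> \<subseteq> M \<and> pathstart \<gamma> = p \<and> pathfinish \<gamma> = q \<and>
               (F \<circ> \<gamma>) piecewise_C1_differentiable_on {0..1} \<and>
               ((\<lambda>t. norm (vector_derivative (F \<circ> \<gamma>) (at t))) has_integral l) {0..1}}"

definition complete_hypersurface ::
    "'p::topological_space set \<Rightarrow> ('p \<Rightarrow> 'a::euclidean_space) \<Rightarrow> bool" where
  "complete_hypersurface M F \<longleftrightarrow> Metric_space.mcomplete M (induced_dist M F)"

section \<open>Extrinsic geometry\<close>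

definition tangent_space ::
    "('p, 'm::euclidean_space) chart \<Rightarrow> ('p \<Rightarrow> 'a::euclidean_space) \<Rightarrow> 'p \<Rightarrow> 'a set" where
  "tangent_space c F p = range (dir_deriv c F p)"

definition tangent_part ::
    "('p, 'm::euclidean_space) chart \<Rightarrow> ('p \<Rightarrow> 'a::euclidean_space) \<Rightarrow> 'p \<Rightarrow> 'a \<Rightarrow> 'a" where
  "tangent_part c F p x = (THE y. y \<in> tangent_space c F p \<and> x - y \<in> (tangent_space c F p)\<^sup>\<bottom>)"

definition normal_part ::
    "('p, 'm::euclidean_space) chart \<Rightarrow> ('p \<Rightarrow> 'a::euclidean_space) \<Rightarrow> 'p \<Rightarrow> 'a \<Rightarrow> 'a" where
  "normal_part c F p x = x - tangent_part c F p x"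

definition unit_normal ::
    "('p, 'm::euclidean_space) chart \<Rightarrow> ('p \<Rightarrow> 'a::euclidean_space) \<Rightarrow> 'p \<Rightarrow> 'a \<Rightarrow> bool" where
  "unit_normal c F p \<nu> \<longleftrightarrow> \<nu> \<in> (tangent_space c F p)\<^sup>\<bottom> \<and> norm \<nu> = 1"

text \<open>$A(X,Y) = (\overline\nabla_X Y)^\perp$ for tangent vectors \<open>X\<close>, \<open>Y\<close> at \<open>p\<close>, where \<open>Y\<close> is
  extended to the tangent field with constant coordinates in the chart. Any other extension
  gives the same value, see \<open>second_ff_extension\<close> below.\<close>

definition second_ff ::
    "('p, 'm::euclidean_space) chart \<Rightarrow> ('p \<Rightarrow> 'a::euclidean_space) \<Rightarrow> 'p \<Rightarrow> 'a \<Rightarrow> 'a \<Rightarrow> 'a" where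
  "second_ff c F p X Y =
     (let u = inv (dir_deriv c F p) X; w = inv (dir_deriv c F p) Y
      in normal_part c F p (dir_deriv c (\<lambda>q. dir_deriv c F q w) p u))"

text \<open>Traces and norms below do not depend on the chosen orthonormal basis.\<close>

definition tangent_basis ::
    "('p, 'm::euclidean_space) chart \<Rightarrow> ('p \<Rightarrow> 'a::euclidean_space) \<Rightarrow> 'p \<Rightarrow> 'a set" where
  "tangent_basis c F p =
     (SOME B. pairwise orthogonal B \<and> (\<forall>e\<in>B. norm e = 1) \<and> span B = tangent_space c F p)"

definition mean_curvature_vector ::
    "('p, 'm::euclidean_space) chart \<Rightarrow> ('p \<Rightarrow> 'a::euclidean_space) \<Rightarrow> 'p \<Rightarrow> 'a" where
  "mean_curvature_vector c F p = (\<Sum>e\<in>tangent_basis c F p. second_ff c F p e e)"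

definition second_ff_norm_sq ::
    "('p, 'm::euclidean_space) chart \<Rightarrow> ('p \<Rightarrow> 'a::euclidean_space) \<Rightarrow> 'p \<Rightarrow> real" where
  "second_ff_norm_sq c F p =
     (\<Sum>e\<in>tangent_basis c F p. \<Sum>f\<in>tangent_basis c F p. (norm (second_ff c F p e f))\<^sup>2)"

text \<open>Scalar quantities with respect to a unit normal \<open>\<nu>\<close> at \<open>p\<close>; the sign convention is
  $\mathbf{H} = -H\nu$.\<close>

definition mean_curvature ::
    "('p, 'm::euclidean_space) chart \<Rightarrow> ('p \<Rightarrow> 'a::euclidean_space) \<Rightarrow> 'p \<Rightarrow> 'a \<Rightarrow> real" where
  "mean_curvature c F p \<nu> = - (mean_curvature_vector c F p \<bullet> \<nu>)"

definition scalar_second_ff ::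
    "('p, 'm::euclidean_space) chart \<Rightarrow> ('p \<Rightarrow> 'a::euclidean_space) \<Rightarrow> 'p \<Rightarrow> 'a \<Rightarrow> 'a \<Rightarrow> 'a \<Rightarrow> real"
  where "scalar_second_ff c F p \<nu> X Y = second_ff c F p X Y \<bullet> \<nu>"

definition self_expander ::
    "('p, 'm::euclidean_space) chart set \<Rightarrow> ('p \<Rightarrow> 'a::euclidean_space) \<Rightarrow> bool" where
  "self_expander \<A> F \<longleftrightarrow>
     (\<forall>c\<in>\<A>. \<forall>p\<in>fst c. mean_curvature_vector c F p = (1/2) *\<^sub>R normal_part c F p (F p))"

section \<open>Independence of the extension in the second fundamental form\<close>

lemma tangent_part_eqI:
  fixes F :: "'p \<Rightarrow> 'a::euclidean_space" and c :: "('p, 'm::euclidean_space) chart"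
  assumes lin: "linear (dir_deriv c F p)"
    and y: "y \<in> tangent_space c F p" and xy: "x - y \<in> (tangent_space c F p)\<^sup>\<bottom>"
  shows "tangent_part c F p x = y"
  unfolding tangent_part_def
proof (rule the_equality)
  show "y \<in> tangent_space c F p \<and> x - y \<in> (tangent_space c F p)\<^sup>\<bottom>" using y xy by simp
next
  fix z assume z: "z \<in> tangent_space c F p \<and> x - z \<in> (tangent_space c F p)\<^sup>\<bottom>"
  have sub: "subspace (tangent_space c F p)"
    unfolding tangent_space_def by (rule linear_subspace_image[OF lin subspace_UNIV])
  have "z - y \<in> tangent_space c F p" using sub y z by (simp add: subspace_diff)
  moreover have "(x - y) - (x - z) \<in> (tangent_space c F p)\<^sup>\<bottom>"
    using subspace_diff[OF subspace_orthogonal_comp] xy z by blast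
  hence "z - y \<in> (tangent_space c F p)\<^sup>\<bottom>" by simp
  ultimately have "orthogonal (z - y) (z - y)" unfolding orthogonal_comp_def by blast
  thus "z = y" by (simp add: orthogonal_def)
qed

lemma normal_part_add_tangent:
  fixes F :: "'p \<Rightarrow> 'a::euclidean_space" and c :: "('p, 'm::euclidean_space) chart"
  assumes lin: "linear (dir_deriv c F p)" and t: "t \<in> tangent_space c F p"
  shows "normal_part c F p (x + t) = normal_part c F p x"
proof -
  have sub: "subspace (tangent_space c F p)"
    unfolding tangent_space_def by (rule linear_subspace_image[OF lin subspace_UNIV])
  obtain y z where y: "y \<in> span (tangent_space c F p)"
    and z: "\<And>w. w \<in> span (tangent_space c F p) \<Longrightarrow> orthogonal z w" and x: "x = y + z"
    using orthogonal_subspace_decomp_exists by metis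
  have y': "y \<in> tangent_space c F p" using y sub by (simp add: span_eq_iff[THEN iffD2])
  have z': "z \<in> (tangent_space c F p)\<^sup>\<bottom>"
    unfolding orthogonal_comp_def using z by (auto simp: orthogonal_commute span_base)
  have "tangent_part c F p x = y" using tangent_part_eqI[OF lin y'] z' x by simp
  moreover have "tangent_part c F p (x + t) = y + t"
    using tangent_part_eqI[OF lin subspace_add[OF sub y' t]] z' x by (simp add: algebra_simps)
  ultimately show ?thesis by (simp add: normal_part_def)
qed

lemma second_ff_extension:
  fixes F :: "'p::{t2_space, second_countable_topology} \<Rightarrow> 'a::euclidean_space"
    and \<A> :: "('p, 'm::euclidean_space) chart set"
  assumes hyp: "immersed_hypersurface M \<A> F" and c: "c \<in> \<A>" and p: "p \<in> fst c"
    and Y: "\<And>q. q \<in> fst c \<Longrightarrow> Y q = dir_deriv c F q (w q)"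
    and w: "(w \<circ> param c) differentiable (at (snd c p))"
  shows "second_ff c F p (dir_deriv c F p u) (Y p) = normal_part c F p (dir_deriv c Y p u)"
proof -
  define G where "G = F \<circ> param c"
  define V where "V = snd c ` fst c"
  define y where "y = snd c p"
  define W where "W = w \<circ> param c"
  have ch: "is_chart M c" and sm: "smooth_on V G" and inj: "inj (dir_deriv c F p)"
    using hyp c p unfolding immersed_hypersurface_def smooth_atlas_def smooth_immersion_def
      V_def G_def by auto
  have opV: "open V" and yV: "y \<in> V" using ch p unfolding is_chart_def V_def y_def by auto
  have inv: "param c (snd c q) = q" "snd c (param c z) = z" "param c z \<in> fst c"
    if "q \<in> fst c" "z \<in> V" for q z
    using ch that unfolding is_chart_def V_def homeomorphism_def by auto
  have C1: "Ck_on (Suc k) V G" for k using sm unfolding smooth_on_def by blast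
  have Gd: "G differentiable (at z)" if "z \<in> V" for z using C1[of 0] that by simp
  have Glin: "linear (frechet_derivative G (at z))" if "z \<in> V" for z
    using linear_frechet_derivative[OF Gd[OF that]] .
  have DGd: "(\<lambda>z. frechet_derivative G (at z) v) differentiable (at y)" for v
    using C1[of "Suc 0"] yV by auto
  define D2 where "D2 v = frechet_derivative (\<lambda>z. frechet_derivative G (at z) v) (at y)" for v
  have D2: "((\<lambda>z. frechet_derivative G (at z) v) has_derivative D2 v) (at y)" for v
    unfolding D2_def using DGd frechet_derivative_works by blast
  define W' where "W' = frechet_derivative W (at y)"
  have W': "(W has_derivative W') (at y)"
    unfolding W'_def using w frechet_derivative_works W_def y_def by blast
  have ddF: "dir_deriv c F q = frechet_derivative G (at (snd c q))" for q
    by (rule ext) (simp add: dir_deriv_def G_def)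
  have dec: "frechet_derivative G (at z) v =
      (\<Sum>b\<in>Basis. (v \<bullet> b) *\<^sub>R frechet_derivative G (at z) b)" if "z \<in> V" for z v
  proof -
    have "frechet_derivative G (at z) (\<Sum>b\<in>Basis. (v \<bullet> b) *\<^sub>R b) =
        (\<Sum>b\<in>Basis. (v \<bullet> b) *\<^sub>R frechet_derivative G (at z) b)"
      using Glin[OF that] by (simp add: linear_sum linear_cmul)
    thus ?thesis by (simp add: euclidean_representation)
  qed
  have D2dec: "D2 v u = (\<Sum>b\<in>Basis. (v \<bullet> b) *\<^sub>R D2 b u)" for v u
  proof -
    have "((\<lambda>z. \<Sum>b\<in>Basis. (v \<bullet> b) *\<^sub>R frechet_derivative G (at z) b)
        has_derivative (\<lambda>u. \<Sum>b\<in>Basis. (v \<bullet> b) *\<^sub>R D2 b u)) (at y)"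
      by (intro has_derivative_sum has_derivative_scaleR_right D2)
    hence "((\<lambda>z. frechet_derivative G (at z) v)
        has_derivative (\<lambda>u. \<Sum>b\<in>Basis. (v \<bullet> b) *\<^sub>R D2 b u)) (at y)"
      by (rule has_derivative_transform_within_open[OF _ opV yV]) (rule dec[symmetric])
    from has_derivative_unique[OF D2 this] show ?thesis by meson
  qed
  have YW: "(Y \<circ> param c) z = (\<Sum>b\<in>Basis. (W z \<bullet> b) *\<^sub>R frechet_derivative G (at z) b)"
    if "z \<in> V" for z
  proof -
    have "(Y \<circ> param c) z = frechet_derivative G (at z) (W z)"
      using Y[OF inv(3)[OF p that]] inv(2)[OF p that] by (simp add: ddF W_def)
    also note dec[OF that]
    finally show ?thesis .
  qed
  have "((\<lambda>z. \<Sum>b\<in>Basis. (W z \<bullet> b) *\<^sub>R frechet_derivative G (at z) b) has_derivative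
      (\<lambda>u. \<Sum>b\<in>Basis. (W y \<bullet> b) *\<^sub>R D2 b u + (W' u \<bullet> b) *\<^sub>R frechet_derivative G (at y) b)) (at y)"
    by (intro has_derivative_sum has_derivative_scaleR D2 has_derivative_inner_left W')
  hence "((Y \<circ> param c) has_derivative
      (\<lambda>u. \<Sum>b\<in>Basis. (W y \<bullet> b) *\<^sub>R D2 b u + (W' u \<bullet> b) *\<^sub>R frechet_derivative G (at y) b)) (at y)"
    by (rule has_derivative_transform_within_open[OF _ opV yV]) (rule YW[symmetric])
  hence "frechet_derivative (Y \<circ> param c) (at y) =
      (\<lambda>u. \<Sum>b\<in>Basis. (W y \<bullet> b) *\<^sub>R D2 b u + (W' u \<bullet> b) *\<^sub>R frechet_derivative G (at y) b)"
    by (rule frechet_derivative_at[symmetric])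
  hence "dir_deriv c Y p u =
      (\<Sum>b\<in>Basis. (W y \<bullet> b) *\<^sub>R D2 b u + (W' u \<bullet> b) *\<^sub>R frechet_derivative G (at y) b)"
    by (simp only: dir_deriv_def y_def[symmetric])
  also have "\<dots> = D2 (W y) u + frechet_derivative G (at y) (W' u)"
    by (simp only: sum.distrib D2dec[of "W y" u, symmetric] dec[OF yV, of "W' u", symmetric])
  finally have DY: "dir_deriv c Y p u = D2 (W y) u + frechet_derivative G (at y) (W' u)" .
  have wp: "W y = w p" using inv(1)[OF p yV] by (simp add: W_def y_def)
  have Fp: "dir_deriv c F p = frechet_derivative G (at y)" by (simp add: ddF y_def)
  have "((\<lambda>q. dir_deriv c F q (w p)) \<circ> param c) z = frechet_derivative G (at z) (w p)"
    if "z \<in> V" for z using inv(2)[OF p that] by (simp add: ddF)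
  hence "(((\<lambda>q. dir_deriv c F q (w p)) \<circ> param c) has_derivative D2 (w p)) (at y)"
    by (intro has_derivative_transform_within_open[OF D2 opV yV]) simp
  hence "frechet_derivative ((\<lambda>q. dir_deriv c F q (w p)) \<circ> param c) (at y) = D2 (w p)"
    by (rule frechet_derivative_at[symmetric])
  hence DC: "dir_deriv c (\<lambda>q. dir_deriv c F q (w p)) p u = D2 (w p) u"
    by (simp only: dir_deriv_def[of c "\<lambda>q. dir_deriv c F q (w p)"] y_def[symmetric])
  have "second_ff c F p (dir_deriv c F p u) (Y p) = normal_part c F p (D2 (w p) u)"
    unfolding second_ff_def Let_def using Y[OF p] inj DC by (simp add: inv_f_f)
  also have "\<dots> = normal_part c F p (dir_deriv c Y p u)"
    unfolding DY wp by (rule normal_part_add_tangent[symmetric])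
      (use Glin[OF yV] in \<open>auto simp: Fp tangent_space_def\<close>)
  finally show ?thesis .
qed

end

theory Submission
  imports Defs
begin

text \<open>For a unit normal \<open>\<nu>\<close> let \<open>f = F \<bullet> \<nu>\<close>, so that the self-expander equation says \<open>H = - f / 2\<close>. The derivative of
\<open>f\<close> in the direction of the tangential part \<open>t\<close> of the position vector is minus the second fundamental form
\<open>A\<close> on \<open>(t, t)\<close>. The curvature inequality thus says that, wherever \<open>f\<close> is nonzero, \<open>f\<^sup>2\<close> strictly increases
in the direction \<open>-t\<close>; in the same direction the norm of the position vector strictly decreases. Since the
immersion is proper, \<open>f\<^sup>2\<close> has a maximum on each set where \<open>norm F\<close> is bounded by a constant, and moving inward
from a point with \<open>f \<noteq> 0\<close> would exceed it. Hence \<open>f\<close> vanishes identically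
(\<open>support_function_vanishes\<close>).

The hypersurface is now a cone: the position vector is tangent everywhere. Differentiating this and
using the symmetry of the second fundamental form, the normal line is constant in the radial direction
(\<open>normal_parallel_along_rays\<close>). The same maximum argument, applied to a function of the normal line minus a
small multiple of the squared norm of the position vector, shows that such a function is bounded above by its
values at the zeros of \<open>F\<close>. These are finite in number, so the normal takes only finitely many directions,
and by connectedness just one (\<open>normal_constant\<close>). The image therefore lies in a hyperplane through the origin.

As a map into that hyperplane \<open>F\<close> is a proper local homeomorphism. Its target is contractible and its
domain connected, so it is a homeomorphism (\<open>homeomorphism_if_connected\<close>,
\<open>homeomorphism_onto_hyperplane\<close>).\<close>

section \<open>Proper local homeomorphisms onto Euclidean space\<close>

lemma Hausdorff_space_t2: "Hausdorff_space (euclidean :: 'p::t2_space topology)"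
  unfolding Hausdorff_space_def disjnt_def using hausdorff by fastforce

text \<open>The agreement set of two local sections is closed because the domain of \<open>\<Phi>\<close> is Hausdorff, and open
because \<open>\<Phi>\<close> is locally injective.\<close>

lemma sections_agree:
  fixes \<Phi> :: "'p::t2_space \<Rightarrow> 'b::topological_space"
  assumes locinj: "\<And>p. p \<in> M \<Longrightarrow> \<exists>U. openin (top_of_set M) U \<and> p \<in> U \<and> inj_on \<Phi> U"
    and T: "connected T"
    and \<sigma>: "continuous_on T \<sigma>" "\<sigma> \<in> T \<rightarrow> M" "\<And>x. x \<in> T \<Longrightarrow> \<Phi> (\<sigma> x) = x"
    and \<tau>: "continuous_on T \<tau>" "\<tau> \<in> T \<rightarrow> M" "\<And>x. x \<in> T \<Longrightarrow> \<Phi> (\<tau> x) = x"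
    and x0: "x0 \<in> T" "\<sigma> x0 = \<tau> x0" and x: "x \<in> T"
  shows "\<sigma> x = \<tau> x"
proof -
  let ?A = "{x \<in> T. \<sigma> x = \<tau> x}"
  have "closedin (top_of_set T) {x \<in> topspace (top_of_set T). \<sigma> x = \<tau> x}"
    using \<sigma>(1) \<tau>(1) by (intro closedin_continuous_maps_eq[of euclidean] Hausdorff_space_t2) auto
  hence cl: "closedin (top_of_set T) ?A" by simp
  have op: "openin (top_of_set T) ?A"
  proof (subst openin_subopen, intro ballI)
    fix y assume y: "y \<in> ?A"
    then obtain U where U: "openin (top_of_set M) U" "\<sigma> y \<in> U" "inj_on \<Phi> U"
      using locinj[of "\<sigma> y"] \<sigma>(2) by blast
    let ?W = "(T \<inter> \<sigma> -` U) \<inter> (T \<inter> \<tau> -` U)"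
    have "openin (top_of_set T) ?W"
      using continuous_openin_preimage[OF \<sigma>(1,2) U(1)] continuous_openin_preimage[OF \<tau>(1,2) U(1)]
      by (rule openin_Int)
    moreover have "y \<in> ?W" using y U by auto
    moreover have "?W \<subseteq> ?A"
      using inj_onD[OF U(3)] \<sigma>(3) \<tau>(3) by auto
    ultimately show "\<exists>W. openin (top_of_set T) W \<and> y \<in> W \<and> W \<subseteq> ?A" by blast
  qed
  have "?A = T" using T cl op x0 unfolding connected_clopen by blast
  thus ?thesis using x by blast
qed

text \<open>If \<open>M\<close> is connected and nonempty, such a map is a covering of a simply connected space, hence a
homeomorphism. Its inverse is found as a global section, built on balls of growing radius around the
image of one point.\<close>

locale proper_local_homeo =
  fixes M :: "'p::t2_space set" and \<Phi> :: "'p \<Rightarrow> 'b::euclidean_space"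
  assumes continuous: "continuous_on M \<Phi>"
    and proper: "compact K \<Longrightarrow> compact {p \<in> M. \<Phi> p \<in> K}"
    and local_inverse: "p \<in> M \<Longrightarrow>
      \<exists>U g. openin (top_of_set M) U \<and> p \<in> U \<and> open (\<Phi> ` U) \<and> homeomorphism U (\<Phi> ` U) \<Phi> g"
begin

definition section_on :: "'b set \<Rightarrow> ('b \<Rightarrow> 'p) \<Rightarrow> bool" where
  "section_on T \<sigma> \<longleftrightarrow> continuous_on T \<sigma> \<and> \<sigma> \<in> T \<rightarrow> M \<and> (\<forall>x\<in>T. \<Phi> (\<sigma> x) = x)"

lemma section_on_subset: "section_on T \<sigma> \<Longrightarrow> S \<subseteq> T \<Longrightarrow> section_on S \<sigma>"
  unfolding section_on_def using continuous_on_subset by blast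

lemma locally_injective: "p \<in> M \<Longrightarrow> \<exists>U. openin (top_of_set M) U \<and> p \<in> U \<and> inj_on \<Phi> U"
  using local_inverse[of p] unfolding homeomorphism_def by (metis inj_on_inverseI)

lemma section_unique:
  assumes "connected T" "section_on T \<sigma>" "section_on T \<tau>" "x0 \<in> T" "\<sigma> x0 = \<tau> x0" "x \<in> T"
  shows "\<sigma> x = \<tau> x"
proof -
  note s = assms(2,3)[unfolded section_on_def]
  show ?thesis
    by (rule sections_agree[OF locally_injective assms(1), of \<sigma> \<tau> x0 x]) (use s assms in auto)
qed

lemma section_glue:
  assumes T: "\<And>i. i \<in> I \<Longrightarrow> open (T i)" and sec: "\<And>i. i \<in> I \<Longrightarrow> section_on (T i) (\<sigma> i)"
    and agree: "\<And>i j x. \<lbrakk>i \<in> I; j \<in> I; x \<in> T i; x \<in> T j\<rbrakk> \<Longrightarrow> \<sigma> i x = \<sigma> j x"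
  obtains \<tau> where "section_on (\<Union>i\<in>I. T i) \<tau>" "\<And>i x. \<lbrakk>i \<in> I; x \<in> T i\<rbrakk> \<Longrightarrow> \<tau> x = \<sigma> i x"
proof -
  define \<tau> where "\<tau> x = \<sigma> (SOME i. i \<in> I \<and> x \<in> T i) x" for x
  have eq: "\<tau> x = \<sigma> i x" if "i \<in> I" "x \<in> T i" for i x
    using someI[of "\<lambda>i. i \<in> I \<and> x \<in> T i" i] that agree unfolding \<tau>_def by blast
  have "continuous_on (T i) \<tau>" if "i \<in> I" for i
    using sec[OF that] eq[OF that] unfolding section_on_def by (auto cong: continuous_on_cong)
  hence "continuous_on (\<Union>i\<in>I. T i) \<tau>" using T by (intro continuous_on_open_UN)
  moreover have "\<tau> x \<in> M \<and> \<Phi> (\<tau> x) = x" if x: "x \<in> (\<Union>i\<in>I. T i)" for x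
  proof -
    obtain i where i: "i \<in> I" "x \<in> T i" using x by blast
    thus ?thesis using eq[OF i] sec[OF i(1)] unfolding section_on_def by auto
  qed
  ultimately show thesis using eq by (intro that) (auto simp: section_on_def)
qed

text \<open>Properness supplies a point \<open>p\<close> over \<open>x\<close> in the closure of the image of \<open>\<sigma>\<close>. A local inverse of
\<open>\<Phi>\<close> at \<open>p\<close> meets that image, hence agrees with \<open>\<sigma>\<close> on the convex set where both are defined.\<close>

lemma section_extends_across_boundary_point:
  assumes R: "R > 0" and \<sigma>: "section_on (ball x0 R) \<sigma>" and x: "x \<in> sphere x0 R"
  shows "\<exists>\<delta> \<tau>. \<delta> > 0 \<and> section_on (ball x \<delta>) \<tau> \<and> (\<forall>y \<in> ball x \<delta> \<inter> ball x0 R. \<tau> y = \<sigma> y)"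
proof -
  let ?K = "{p \<in> M. \<Phi> p \<in> cball x0 R}"
  let ?C = "?K \<inter> closure (\<sigma> ` ball x0 R)"
  have "compact ?C" by (intro compact_Int_closed proper) auto
  hence "closed (\<Phi> ` ?C)"
    by (intro compact_imp_closed compact_continuous_image continuous_on_subset[OF continuous]) auto
  moreover have "y \<in> \<Phi> ` ?C" if "y \<in> ball x0 R" for y
    using \<sigma> that closure_subset[of "\<sigma> ` ball x0 R"] unfolding section_on_def
    by (intro image_eqI[of _ _ "\<sigma> y"]) (auto simp: less_imp_le)
  ultimately have "closure (ball x0 R) \<subseteq> \<Phi> ` ?C" by (intro closure_minimal subsetI)
  hence "x \<in> \<Phi> ` ?C" using x R by (auto simp: closure_ball)
  then obtain p where p: "p \<in> M" "\<Phi> p = x" "p \<in> closure (\<sigma> ` ball x0 R)" by blast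
  from local_inverse[OF p(1)] obtain U g where U: "openin (top_of_set M) U" "p \<in> U" "open (\<Phi> ` U)"
    and g: "homeomorphism U (\<Phi> ` U) \<Phi> g" by blast
  obtain \<delta> where \<delta>: "\<delta> > 0" "ball x \<delta> \<subseteq> \<Phi> ` U"
    using U(2,3) p(2) open_contains_ball by blast
  have UM: "U \<subseteq> M" using openin_imp_subset[OF U(1)] .
  have "section_on (\<Phi> ` U) g"
    using g UM unfolding section_on_def homeomorphism_def by auto
  hence sg: "section_on (ball x \<delta>) g" by (rule section_on_subset[OF _ \<delta>(2)])
  have "openin (top_of_set M) (U \<inter> (M \<inter> \<Phi> -` ball x \<delta>))"
    using U(1) continuous_openin_preimage_gen[OF continuous open_ball] by (rule openin_Int)
  then obtain Q where Q: "open Q" "U \<inter> (M \<inter> \<Phi> -` ball x \<delta>) = M \<inter> Q"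
    by (auto simp: openin_open)
  have "p \<in> Q" using p U \<delta> Q by auto
  then obtain y where y: "y \<in> ball x0 R" "\<sigma> y \<in> Q"
    using p(3) Q(1) unfolding closure_iff_nhds_not_empty by blast
  have "\<sigma> y \<in> M" "\<Phi> (\<sigma> y) = y" using \<sigma> y(1) unfolding section_on_def by auto
  hence "\<sigma> y \<in> U \<inter> (M \<inter> \<Phi> -` ball x \<delta>)" using Q y(2) by blast
  hence "\<sigma> y \<in> U" "y \<in> ball x \<delta>" using \<open>\<Phi> (\<sigma> y) = y\<close> by auto
  hence gy: "g y = \<sigma> y" using g \<open>\<Phi> (\<sigma> y) = y\<close> unfolding homeomorphism_def by metis
  let ?B = "ball x \<delta> \<inter> ball x0 R"
  have conn: "connected ?B" by (intro convex_connected convex_Int) auto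
  have sec: "section_on ?B g" "section_on ?B \<sigma>"
    using section_on_subset[OF sg, of ?B] section_on_subset[OF \<sigma>, of ?B] by simp_all
  have yB: "y \<in> ?B" using y(1) \<open>y \<in> ball x \<delta>\<close> by simp
  have "g z = \<sigma> z" if "z \<in> ?B" for z
    by (rule section_unique[of ?B g \<sigma> y z, OF conn sec yB gy that])
  thus ?thesis using sg \<delta>(1) by (intro exI[of _ \<delta>] exI[of _ g]) simp
qed

text \<open>The extensions at the boundary points are glued. Two of the small balls that meet also meet inside
the large ball, by strict convexity, and there both extensions equal \<open>\<sigma>\<close>. Compactness of the closed
ball then leaves room for a larger radius.\<close>

lemma section_extends_past_ball:
  assumes R: "R > 0" and \<sigma>: "section_on (ball x0 R) \<sigma>"
  shows "\<exists>R' \<tau>. R' > R \<and> section_on (ball x0 R') \<tau> \<and> \<tau> x0 = \<sigma> x0"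
proof -
  define ext where "ext x \<delta> \<tau> \<longleftrightarrow> \<delta> > 0 \<and> section_on (ball x \<delta>) \<tau> \<and>
    (\<forall>y \<in> ball x \<delta> \<inter> ball x0 R. \<tau> y = \<sigma> y)" for x \<delta> \<tau>
  have "\<forall>x\<in>sphere x0 R. \<exists>\<delta> \<tau>. ext x \<delta> \<tau>"
    using section_extends_across_boundary_point[OF R \<sigma>] unfolding ext_def by (intro ballI)
  then obtain \<delta> \<tau> where ext: "\<And>x. x \<in> sphere x0 R \<Longrightarrow> ext x (\<delta> x) (\<tau> x)" by metis
  have \<delta>: "\<delta> x > 0" and \<tau>: "section_on (ball x (\<delta> x)) (\<tau> x)"
    and agr: "\<And>y. y \<in> ball x (\<delta> x) \<Longrightarrow> y \<in> ball x0 R \<Longrightarrow> \<tau> x y = \<sigma> y"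
    if "x \<in> sphere x0 R" for x
    using ext[OF that] unfolding ext_def by auto
  define D where "D x = (if x = x0 then R else \<delta> x)" for x
  define \<rho> where "\<rho> x = (if x = x0 then \<sigma> else \<tau> x)" for x
  let ?J = "insert x0 (sphere x0 R)"
  have x0: "x0 \<notin> sphere x0 R" using R by auto
  have sec: "section_on (ball x (D x)) (\<rho> x)" if "x \<in> ?J" for x
    using that \<sigma> \<tau> unfolding D_def \<rho>_def by auto
  have sphere_agree: "\<tau> x z = \<tau> y z" if xy: "x \<in> sphere x0 R" "y \<in> sphere x0 R" "x \<noteq> y"
    and z: "z \<in> ball x (\<delta> x)" "z \<in> ball y (\<delta> y)" for x y z
  proof -
    \<comment> \<open>The point \<open>m\<close> of the segment from \<open>x\<close> to \<open>y\<close> lies in both small balls, and inside the large one.\<close>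
    define \<theta> where "\<theta> = \<delta> x / (\<delta> x + \<delta> y)"
    define m where "m = (1 - \<theta>) *\<^sub>R x + \<theta> *\<^sub>R y"
    have pos: "\<delta> x > 0" "\<delta> y > 0" using \<delta> xy by auto
    have \<theta>: "0 < \<theta>" "\<theta> < 1" using pos by (auto simp: \<theta>_def field_simps)
    have d: "dist x y < \<delta> x + \<delta> y"
      using z dist_triangle[of x y z] by (auto simp: dist_commute)
    have "x - m = \<theta> *\<^sub>R (x - y)" "y - m = (1 - \<theta>) *\<^sub>R (y - x)"
      by (auto simp: m_def algebra_simps)
    hence dm: "dist x m = \<theta> * dist x y" "dist y m = (1 - \<theta>) * dist x y"
      using \<theta> by (auto simp: dist_norm norm_minus_commute)
    have "1 - \<theta> = \<delta> y / (\<delta> x + \<delta> y)" using pos by (simp add: \<theta>_def field_simps)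
    hence mm: "m \<in> ball x (\<delta> x)" "m \<in> ball y (\<delta> y)"
      using d pos by (auto simp: dm \<theta>_def pos_divide_less_eq mult.commute)
    have "m \<in> open_segment x y" unfolding in_segment m_def using \<theta> xy(3) by auto
    hence "dist x0 m < R" using dist_decreases_open_segment[of m x y x0] xy by auto
    hence "\<tau> x m = \<tau> y m" using agr xy mm by auto
    let ?B = "ball x (\<delta> x) \<inter> ball y (\<delta> y)"
    have conn: "connected ?B" by (intro convex_connected convex_Int) auto
    have sec: "section_on ?B (\<tau> x)" "section_on ?B (\<tau> y)"
      using section_on_subset[OF \<tau>[OF xy(1)], of ?B] section_on_subset[OF \<tau>[OF xy(2)], of ?B]
      by simp_all
    have mzB: "m \<in> ?B" "z \<in> ?B" using mm z by simp_all
    show ?thesis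
      by (rule section_unique[of ?B "\<tau> x" "\<tau> y" m z,
            OF conn sec mzB(1) \<open>\<tau> x m = \<tau> y m\<close> mzB(2)])
  qed
  obtain \<kappa> where \<kappa>: "section_on (\<Union>x\<in>?J. ball x (D x)) \<kappa>"
    and \<kappa>x: "\<And>x y. \<lbrakk>x \<in> ?J; y \<in> ball x (D x)\<rbrakk> \<Longrightarrow> \<kappa> y = \<rho> x y"
  proof (rule section_glue[of ?J "\<lambda>x. ball x (D x)" \<rho>])
    show "\<rho> x z = \<rho> y z" if "x \<in> ?J" "y \<in> ?J" "z \<in> ball x (D x)" "z \<in> ball y (D y)" for x y z
    proof (cases "x = x0 \<or> y = x0 \<or> x = y")
      case True
      thus ?thesis using that agr x0 unfolding \<rho>_def D_def by (auto split: if_splits)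
    next
      case False
      hence "x \<in> sphere x0 R" "y \<in> sphere x0 R" using that by auto
      thus ?thesis using sphere_agree[of x y z] that False unfolding \<rho>_def D_def by simp
    qed
  qed (use sec in auto)
  let ?W = "\<Union>x\<in>?J. ball x (D x)"
  have sub: "cball x0 R \<subseteq> ?W"
  proof
    fix x assume x: "x \<in> cball x0 R"
    show "x \<in> ?W"
    proof (cases "dist x0 x = R")
      case True
      thus ?thesis using \<delta>[of x] x0 by (intro UN_I[of x]) (auto simp: D_def)
    next
      case False
      thus ?thesis using x by (intro UN_I[of x0]) (auto simp: D_def)
    qed
  qed
  have "open ?W" by (intro open_UN ballI open_ball)
  from compact_subset_open_imp_ball_epsilon_subset[OF compact_cball this sub]
  obtain e where e: "e > 0" "(\<Union>x\<in>cball x0 R. ball x e) \<subseteq> ?W" .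
  have "ball x0 (R + e) \<subseteq> ?W"
  proof
    fix y assume y: "y \<in> ball x0 (R + e)"
    have "\<exists>x\<in>cball x0 R. y \<in> ball x e"
    proof (cases "dist x0 y \<le> R")
      case True thus ?thesis using e by (intro bexI[of _ y]) auto
    next
      case False
      define r where "r = norm (y - x0)"
      have r: "r > R" "r < R + e" using False y by (auto simp: r_def dist_norm norm_minus_commute)
      define x where "x = x0 + (R / r) *\<^sub>R (y - x0)"
      have "y - x = (1 - R / r) *\<^sub>R (y - x0)" by (simp add: x_def algebra_simps)
      hence "norm (y - x) = \<bar>1 - R / r\<bar> * r" by (simp add: r_def)
      also have "\<dots> = r - R" using r R by (simp add: field_simps abs_if)
      finally have "y \<in> ball x e" using r by (simp add: dist_norm norm_minus_commute)
      moreover have "norm (x - x0) = R" using r R by (simp add: x_def r_def[symmetric])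
      hence "x \<in> cball x0 R" by (simp add: dist_norm norm_minus_commute)
      ultimately show ?thesis by blast
    qed
    thus "y \<in> ?W" by (intro subsetD[OF e(2)]) simp
  qed
  hence "section_on (ball x0 (R + e)) \<kappa>" by (rule section_on_subset[OF \<kappa>])
  moreover have "\<kappa> x0 = \<sigma> x0" using \<kappa>x[of x0 x0] R by (simp add: D_def \<rho>_def)
  ultimately show ?thesis using e(1) by (intro exI[of _ "R + e"] exI[of _ \<kappa>]) auto
qed

lemma global_section:
  assumes p0: "p0 \<in> M"
  obtains \<sigma> where "section_on UNIV \<sigma>" "\<sigma> (\<Phi> p0) = p0"
proof -
  define x0 where "x0 = \<Phi> p0"
  define I where "I = {R. R > 0 \<and> (\<exists>\<sigma>. section_on (ball x0 R) \<sigma> \<and> \<sigma> x0 = p0)}"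
  obtain U g where U: "openin (top_of_set M) U" "p0 \<in> U" "open (\<Phi> ` U)"
    and g: "homeomorphism U (\<Phi> ` U) \<Phi> g" using local_inverse[OF p0] by blast
  obtain r where r: "r > 0" "ball x0 r \<subseteq> \<Phi> ` U"
    using U(2,3) open_contains_ball unfolding x0_def by blast
  have "section_on (\<Phi> ` U) g"
    using g openin_imp_subset[OF U(1)] unfolding section_on_def homeomorphism_def by auto
  hence "section_on (ball x0 r) g" by (rule section_on_subset[OF _ r(2)])
  moreover have "g x0 = p0" using g U(2) unfolding homeomorphism_def x0_def by auto
  ultimately have rI: "r \<in> I" using r(1) unfolding I_def by blast
  have "\<forall>R\<in>I. \<exists>\<sigma>. section_on (ball x0 R) \<sigma> \<and> \<sigma> x0 = p0" unfolding I_def by blast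
  then obtain \<sigma> where \<sigma>: "\<And>R. R \<in> I \<Longrightarrow> section_on (ball x0 R) (\<sigma> R)" "\<And>R. R \<in> I \<Longrightarrow> \<sigma> R x0 = p0"
    by metis
  obtain \<tau> where \<tau>: "section_on (\<Union>R\<in>I. ball x0 R) \<tau>"
    and \<tau>x: "\<And>R x. \<lbrakk>R \<in> I; x \<in> ball x0 R\<rbrakk> \<Longrightarrow> \<tau> x = \<sigma> R x"
  proof (rule section_glue[of I "ball x0" \<sigma>])
    show "\<sigma> R x = \<sigma> S x" if "R \<in> I" "S \<in> I" "x \<in> ball x0 R" "x \<in> ball x0 S" for R S x
    proof -
      let ?B = "ball x0 R \<inter> ball x0 S"
      have conn: "connected ?B" by (intro convex_connected convex_Int) auto
      have sec: "section_on ?B (\<sigma> R)" "section_on ?B (\<sigma> S)"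
        using section_on_subset[OF \<sigma>(1)[OF that(1)], of ?B]
          section_on_subset[OF \<sigma>(1)[OF that(2)], of ?B] by simp_all
      have x0B: "x0 \<in> ?B" and xB: "x \<in> ?B" using that by (auto simp: I_def)
      have eq: "\<sigma> R x0 = \<sigma> S x0" using that \<sigma>(2) by simp
      show ?thesis by (rule section_unique[of ?B "\<sigma> R" "\<sigma> S" x0 x, OF conn sec x0B eq xB])
    qed
  qed (use \<sigma> in auto)
  have \<tau>0: "\<tau> x0 = p0" using \<tau>x[OF rI, of x0] \<sigma>(2)[OF rI] r(1) by simp
  have "\<not> bdd_above I"
  proof
    assume bdd: "bdd_above I"
    have Sp: "Sup I > 0" using cSup_upper[OF rI bdd] r(1) by linarith
    have "ball x0 (Sup I) \<subseteq> (\<Union>R\<in>I. ball x0 R)"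
    proof
      fix x assume "x \<in> ball x0 (Sup I)"
      hence "dist x0 x < Sup I" by simp
      then obtain R where "R \<in> I" "dist x0 x < R" using less_cSup_iff[OF _ bdd] rI by blast
      thus "x \<in> (\<Union>R\<in>I. ball x0 R)" by auto
    qed
    hence "section_on (ball x0 (Sup I)) \<tau>" by (rule section_on_subset[OF \<tau>])
    from section_extends_past_ball[OF Sp this] obtain R' \<tau>'
      where R': "R' > Sup I" and \<tau>': "section_on (ball x0 R') \<tau>'" "\<tau>' x0 = p0"
      unfolding \<tau>0 by blast
    have "R' \<in> I" unfolding I_def using R' Sp \<tau>' by auto
    thus False using cSup_upper[OF _ bdd, of R'] R' by simp
  qed
  hence "\<exists>R\<in>I. dist x0 x < R" for x unfolding bdd_above_def by (meson not_le)
  hence "(\<Union>R\<in>I. ball x0 R) = UNIV" by auto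
  thus thesis using that \<tau> \<tau>0 unfolding x0_def by simp
qed

text \<open>The image of a global section is closed and open in \<open>M\<close>, so by connectedness the section is a
two-sided inverse.\<close>

theorem homeomorphism_if_connected:
  assumes M: "connected M" "M \<noteq> {}"
  shows "\<exists>g. homeomorphism M UNIV \<Phi> g"
proof -
  obtain p0 where p0: "p0 \<in> M" using M by blast
  then obtain \<sigma> where \<sigma>: "section_on UNIV \<sigma>" "\<sigma> (\<Phi> p0) = p0" using global_section by blast
  have \<sigma>c: "continuous_on UNIV \<sigma>" and \<sigma>M: "\<sigma> x \<in> M" and \<Phi>\<sigma>: "\<Phi> (\<sigma> x) = x" for x
    using \<sigma>(1) unfolding section_on_def by auto
  let ?A = "{p \<in> M. \<sigma> (\<Phi> p) = p}"
  have c: "continuous_on M (\<lambda>p. \<sigma> (\<Phi> p))"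
    by (rule continuous_on_compose2[OF \<sigma>c continuous]) auto
  have "closedin (top_of_set M) {p \<in> topspace (top_of_set M). \<sigma> (\<Phi> p) = p}"
    using c by (intro closedin_continuous_maps_eq[of euclidean] Hausdorff_space_t2) auto
  moreover have "openin (top_of_set M) ?A"
  proof (subst openin_subopen, intro ballI)
    fix p assume p: "p \<in> ?A"
    then obtain U where U: "openin (top_of_set M) U" "p \<in> U" "inj_on \<Phi> U"
      using locally_injective[of p] by blast
    let ?W = "U \<inter> (M \<inter> (\<lambda>p. \<sigma> (\<Phi> p)) -` U)"
    have "openin (top_of_set M) ?W"
      by (intro openin_Int U(1) continuous_openin_preimage[OF c _ U(1)]) (use \<sigma>M in auto)
    moreover have "p \<in> ?W" using p U by auto
    moreover have "?W \<subseteq> ?A" using inj_onD[OF U(3)] \<Phi>\<sigma> by auto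
    ultimately show "\<exists>W. openin (top_of_set M) W \<and> p \<in> W \<and> W \<subseteq> ?A" by blast
  qed
  moreover have "p0 \<in> ?A" using \<sigma>(2) p0 by simp
  ultimately have "?A = M" using M(1) unfolding connected_clopen by auto
  hence inv: "\<sigma> (\<Phi> p) = p" if "p \<in> M" for p using that by blast
  have "homeomorphism M UNIV \<Phi> \<sigma>"
    by (rule homeomorphismI) (simp_all add: continuous \<sigma>c \<sigma>M \<Phi>\<sigma> inv image_subset_iff)
  thus ?thesis by blast
qed

end

section \<open>Symmetry of second derivatives\<close>

lemma has_real_derivative_along_line:
  fixes f :: "'m::real_normed_vector \<Rightarrow> real"
  assumes "(f has_derivative f') (at (x + s *\<^sub>R u))"
  shows "((\<lambda>s. f (x + s *\<^sub>R u)) has_real_derivative f' u) (at s)"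
proof -
  have "((\<lambda>s. x + s *\<^sub>R u) has_derivative (\<lambda>h. h *\<^sub>R u)) (at s)"
    by (auto intro!: derivative_eq_intros)
  from has_derivative_compose[OF this assms]
  have "((\<lambda>s. f (x + s *\<^sub>R u)) has_derivative (\<lambda>h. f' (h *\<^sub>R u))) (at s)" .
  moreover have "(\<lambda>h. f' (h *\<^sub>R u)) = (*) (f' u)"
    using assms has_derivative_linear[OF assms] by (auto simp: linear_cmul mult.commute)
  ultimately show ?thesis by (simp add: has_field_derivative_def)
qed

text \<open>The mean value theorem, applied once in each of the two directions. The left-hand side is symmetric in
\<open>u\<close> and \<open>v\<close>, which yields the symmetry of second derivatives below.\<close>

lemma second_difference_mean_value:
  fixes g :: "'m::real_normed_vector \<Rightarrow> real"
  assumes t: "t > 0"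
    and Dg: "\<And>y. dist y x \<le> t * (norm u + norm v) \<Longrightarrow> (g has_derivative Dg y) (at y)"
    and H: "\<And>y. dist y x \<le> t * (norm u + norm v) \<Longrightarrow> ((\<lambda>y. Dg y u) has_derivative H y) (at y)"
  shows "\<exists>a. dist a x \<le> t * (norm u + norm v) \<and>
    g (x + t *\<^sub>R u + t *\<^sub>R v) - g (x + t *\<^sub>R u) - g (x + t *\<^sub>R v) + g x = t * t * H a v"
proof -
  have near: "dist (x + s *\<^sub>R u + r *\<^sub>R v) x \<le> t * (norm u + norm v)"
    if "0 \<le> s" "s \<le> t" "0 \<le> r" "r \<le> t" for s r
  proof -
    have "norm (s *\<^sub>R u + r *\<^sub>R v) \<le> s * norm u + r * norm v"
      using norm_triangle_ineq[of "s *\<^sub>R u" "r *\<^sub>R v"] that by simp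
    also have "\<dots> \<le> t * norm u + t * norm v" using that by (intro add_mono mult_right_mono) auto
    finally show ?thesis by (simp add: dist_norm algebra_simps)
  qed
  define \<phi> where "\<phi> s = g ((x + t *\<^sub>R v) + s *\<^sub>R u) - g (x + s *\<^sub>R u)" for s
  have "(\<phi> has_real_derivative Dg ((x + t *\<^sub>R v) + s *\<^sub>R u) u - Dg (x + s *\<^sub>R u) u) (at s)"
    if "0 \<le> s" "s \<le> t" for s
    unfolding \<phi>_def using near[of s t] near[of s 0] that t
    by (intro DERIV_diff has_real_derivative_along_line Dg) (auto simp: add_ac)
  from MVT2[OF t this] obtain \<xi> where \<xi>: "0 < \<xi>" "\<xi> < t"
    and 1: "\<phi> t - \<phi> 0 = t * (Dg ((x + t *\<^sub>R v) + \<xi> *\<^sub>R u) u - Dg (x + \<xi> *\<^sub>R u) u)" by auto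
  have "((\<lambda>r. Dg ((x + \<xi> *\<^sub>R u) + r *\<^sub>R v) u) has_real_derivative H ((x + \<xi> *\<^sub>R u) + r *\<^sub>R v) v) (at r)"
    if "0 \<le> r" "r \<le> t" for r
    by (rule has_real_derivative_along_line[of "\<lambda>y. Dg y u"], rule H) (use near[of \<xi> r] \<xi> that in auto)
  from MVT2[OF t this] obtain \<eta> where \<eta>: "0 < \<eta>" "\<eta> < t"
    and 2: "Dg ((x + \<xi> *\<^sub>R u) + t *\<^sub>R v) u - Dg (x + \<xi> *\<^sub>R u) u = t * H ((x + \<xi> *\<^sub>R u) + \<eta> *\<^sub>R v) v"
    by auto
  have "\<phi> t - \<phi> 0 = t * (t * H ((x + \<xi> *\<^sub>R u) + \<eta> *\<^sub>R v) v)"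
    using 1 2 by (simp add: add_ac)
  thus ?thesis
    using near[of \<xi> \<eta>] \<xi> \<eta> unfolding \<phi>_def
    by (intro exI[of _ "x + \<xi> *\<^sub>R u + \<eta> *\<^sub>R v"]) (simp add: add_ac)
qed

lemma mixed_derivatives_commute_real:
  fixes g :: "'m::real_normed_vector \<Rightarrow> real"
  assumes V: "open V" "x \<in> V"
    and Dg: "\<And>y. y \<in> V \<Longrightarrow> (g has_derivative Dg y) (at y)"
    and H: "\<And>y w. y \<in> V \<Longrightarrow> ((\<lambda>y. Dg y w) has_derivative H w y) (at y)"
    and cont: "\<And>u v. continuous_on V (\<lambda>y. H u y v)"
  shows "H u x v = H v x u"
proof (rule ccontr)
  assume ne: "H u x v \<noteq> H v x u"
  define e where "e = \<bar>H u x v - H v x u\<bar> / 2"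
  have e: "e > 0" using ne by (simp add: e_def)
  have "isCont (\<lambda>y. H u y v) x" "isCont (\<lambda>y. H v y u) x"
    using cont V continuous_on_eq_continuous_at by blast+
  then obtain d1 d2 where d: "d1 > 0" "d2 > 0"
    and d1: "\<And>y. dist y x < d1 \<Longrightarrow> \<bar>H u y v - H u x v\<bar> < e"
    and d2: "\<And>y. dist y x < d2 \<Longrightarrow> \<bar>H v y u - H v x u\<bar> < e"
    using e unfolding continuous_at_eps_delta dist_real_def by metis
  obtain d3 where d3: "d3 > 0" "\<And>y. dist y x < d3 \<Longrightarrow> y \<in> V"
    using V open_dist by metis
  define \<delta> where "\<delta> = min d1 (min d2 d3)"
  define t where "t = \<delta> / (2 * (1 + norm u + norm v))"
  have \<delta>: "\<delta> > 0" using d d3 by (simp add: \<delta>_def)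
  have pos: "1 + norm u + norm v > 0" using norm_ge_zero[of u] norm_ge_zero[of v] by linarith
  have t: "t > 0" using \<delta> pos by (simp add: t_def)
  have "t * (norm u + norm v) \<le> t * (1 + norm u + norm v)" using t by simp
  also have "\<dots> = \<delta> / 2" using pos unfolding t_def by (simp add: divide_simps del: distrib_left_numeral)
  finally have small: "t * (norm u + norm v) < \<delta>" using \<delta> by linarith
  have inV: "y \<in> V" if "dist y x \<le> t * (norm u + norm v)" for y
    using d3 small that by (auto simp: \<delta>_def)
  obtain a where a: "dist a x \<le> t * (norm u + norm v)"
    "g (x + t *\<^sub>R u + t *\<^sub>R v) - g (x + t *\<^sub>R u) - g (x + t *\<^sub>R v) + g x = t * t * H u a v"
    using second_difference_mean_value[where g = g and Dg = Dg and H = "H u" and x = x, OF t] Dg H inV by blast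
  have "t * (norm v + norm u) = t * (norm u + norm v)" by simp
  then obtain b where b: "dist b x \<le> t * (norm u + norm v)"
    "g (x + t *\<^sub>R v + t *\<^sub>R u) - g (x + t *\<^sub>R v) - g (x + t *\<^sub>R u) + g x = t * t * H v b u"
    using second_difference_mean_value[where g = g and Dg = Dg and H = "H v" and x = x and u = v and v = u, OF t] Dg H inV
    by (metis (no_types, lifting))
  have "t * t * H u a v = t * t * H v b u" using a(2) b(2) by (simp add: add_ac algebra_simps)
  hence "H u a v = H v b u" using t by simp
  moreover have "\<bar>H u a v - H u x v\<bar> < e" "\<bar>H v b u - H v x u\<bar> < e"
    using a(1) b(1) small by (auto intro!: d1 d2 simp: \<delta>_def)
  ultimately show False unfolding e_def by (auto simp: abs_if split: if_splits)
qed

lemma mixed_derivatives_commute: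
  fixes G :: "'m::real_normed_vector \<Rightarrow> 'a::euclidean_space"
  assumes V: "open V" "x \<in> V"
    and D: "\<And>y. y \<in> V \<Longrightarrow> (G has_derivative D y) (at y)"
    and H: "\<And>y w. y \<in> V \<Longrightarrow> ((\<lambda>y. D y w) has_derivative H w y) (at y)"
    and cont: "\<And>u v. continuous_on V (\<lambda>y. H u y v)"
  shows "H u x v = H v x u"
proof (rule euclidean_eqI)
  fix b :: 'a
  show "H u x v \<bullet> b = H v x u \<bullet> b"
    by (rule mixed_derivatives_commute_real[where g = "\<lambda>y. G y \<bullet> b" and Dg = "\<lambda>y w. D y w \<bullet> b"
          and H = "\<lambda>w y h. H w y h \<bullet> b", OF V])
      (auto intro!: has_derivative_inner_left D H continuous_intros cont)
qed

section \<open>Local injectivity of immersions\<close>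

lemma linear_norm_le_basis:
  fixes f :: "'m::euclidean_space \<Rightarrow> 'b::real_normed_vector"
  assumes "linear f"
  shows "norm (f v) \<le> (\<Sum>b\<in>Basis. norm (f b)) * norm v"
proof -
  have "f v = f (\<Sum>b\<in>Basis. (v \<bullet> b) *\<^sub>R b)" by (simp add: euclidean_representation)
  also have "\<dots> = (\<Sum>b\<in>Basis. (v \<bullet> b) *\<^sub>R f b)" by (simp add: linear_sum[OF assms] linear_cmul[OF assms])
  finally have "norm (f v) \<le> (\<Sum>b\<in>Basis. norm ((v \<bullet> b) *\<^sub>R f b))" by (simp only: norm_sum)
  also have "\<dots> \<le> (\<Sum>b\<in>Basis. norm v * norm (f b))"
    by (intro sum_mono) (auto intro!: mult_right_mono Basis_le_norm)
  finally show ?thesis by (simp add: sum_distrib_left mult.commute)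
qed

text \<open>Continuity of the directional derivatives gives continuity of the differential in operator norm, so
near \<open>x\<close> the map is a small perturbation of the injective linear map \<open>D x\<close>.\<close>

lemma immersion_locally_injective:
  fixes G :: "'m::euclidean_space \<Rightarrow> 'a::euclidean_space"
  assumes V: "open V" "x \<in> V"
    and D: "\<And>y. y \<in> V \<Longrightarrow> (G has_derivative D y) (at y)"
    and cont: "\<And>v. continuous_on V (\<lambda>y. D y v)"
    and inj: "inj (D x)"
  obtains r where "r > 0" "ball x r \<subseteq> V" "inj_on G (ball x r)"
proof -
  have lin: "linear (D y)" if "y \<in> V" for y using has_derivative_linear[OF D[OF that]] .
  obtain g where g: "linear g" "g \<circ> D x = id"
    using linear_injective_left_inverse[OF lin[OF V(2)] inj] by blast
  have onorm: "\<exists>d>0. \<forall>y. dist x y < d \<longrightarrow> onorm (\<lambda>v. D y v - D x v) < e" if e: "e > 0" for e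
  proof -
    have "((\<lambda>y. \<Sum>b\<in>Basis. norm (D y b - D x b)) \<longlongrightarrow> (\<Sum>b\<in>(Basis::'m set). norm (D x b - D x b))) (nhds x)"
      by (intro tendsto_intros)
        (use cont V in \<open>auto simp: continuous_on_eq_continuous_at tendsto_nhds_iff isCont_def\<close>)
    hence "\<forall>\<^sub>F y in nhds x. (\<Sum>b\<in>Basis. norm (D y b - D x b)) < e"
      using e by (intro order_tendstoD(2)) auto
    moreover have "\<forall>\<^sub>F y in nhds x. y \<in> V" using V by (rule eventually_nhds_in_open)
    ultimately have "\<forall>\<^sub>F y in nhds x. y \<in> V \<and> (\<Sum>b\<in>Basis. norm (D y b - D x b)) < e"
      by (simp add: eventually_conj_iff)
    then obtain d where d: "d > 0"
      "\<And>y. dist y x < d \<Longrightarrow> y \<in> V \<and> (\<Sum>b\<in>Basis. norm (D y b - D x b)) < e"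
      unfolding eventually_nhds_metric by blast
    have "onorm (\<lambda>v. D y v - D x v) < e" if "dist x y < d" for y
    proof -
      have y: "y \<in> V" "(\<Sum>b\<in>Basis. norm (D y b - D x b)) < e" using d(2)[of y] that by (auto simp: dist_commute)
      have "linear (\<lambda>v. D y v - D x v)" using lin y(1) V by (intro linear_compose_sub)
      hence "onorm (\<lambda>v. D y v - D x v) \<le> (\<Sum>b\<in>Basis. norm (D y b - D x b))"
        by (intro onorm_bound sum_nonneg linear_norm_le_basis) auto
      thus ?thesis using y by linarith
    qed
    thus ?thesis using d(1) by blast
  qed
  show thesis
    using has_derivative_locally_injective[of x V g D G, OF V(2,1) _ g(2) D onorm] g(1) that
    by (metis linear_conv_bounded_linear)
qed

section \<open>Differentiable unit normal fields\<close>

text \<open>A product rule for a factor \<open>f\<close> that is only continuous, at a zero of the other factor.\<close>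

lemma has_derivative_scaleR_vanishing:
  fixes f :: "'m::real_normed_vector \<Rightarrow> real" and g :: "'m \<Rightarrow> 'a::real_normed_vector"
  assumes f: "(f \<longlongrightarrow> f x) (at x)" and g: "(g has_derivative g') (at x)" and g0: "g x = 0"
  shows "((\<lambda>y. f y *\<^sub>R g y) has_derivative (\<lambda>h. f x *\<^sub>R g' h)) (at x)"
proof -
  have bl: "bounded_linear g'" using g by (rule has_derivative_bounded_linear)
  obtain B where B: "B > 0" "\<And>h. norm (g' h) \<le> norm h * B" using bounded_linear.pos_bounded[OF bl] by blast
  define q where "q y = norm (g y - g x - g' (y - x)) / norm (y - x)" for y
  have q: "(q \<longlongrightarrow> 0) (at x)" using g unfolding has_derivative_iff_norm q_def by simp
  have "((\<lambda>y. \<bar>f y\<bar> * q y + \<bar>f y - f x\<bar> * B) \<longlongrightarrow> \<bar>f x\<bar> * 0 + \<bar>f x - f x\<bar> * B) (at x)"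
    by (intro tendsto_intros f q)
  hence lim: "((\<lambda>y. \<bar>f y\<bar> * q y + \<bar>f y - f x\<bar> * B) \<longlongrightarrow> 0) (at x)" by simp
  have bnd: "norm (f y *\<^sub>R g y - f x *\<^sub>R g x - f x *\<^sub>R g' (y - x)) / norm (y - x)
      \<le> \<bar>f y\<bar> * q y + \<bar>f y - f x\<bar> * B" if "y \<noteq> x" for y
  proof -
    have "f y *\<^sub>R g y - f x *\<^sub>R g x - f x *\<^sub>R g' (y - x)
        = f y *\<^sub>R (g y - g x - g' (y - x)) + (f y - f x) *\<^sub>R g' (y - x)"
      by (simp add: g0 algebra_simps)
    hence "norm (f y *\<^sub>R g y - f x *\<^sub>R g x - f x *\<^sub>R g' (y - x))
        \<le> \<bar>f y\<bar> * norm (g y - g x - g' (y - x)) + \<bar>f y - f x\<bar> * norm (g' (y - x))"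
      by (metis norm_scaleR norm_triangle_ineq)
    also have "\<dots> \<le> \<bar>f y\<bar> * norm (g y - g x - g' (y - x)) + \<bar>f y - f x\<bar> * (norm (y - x) * B)"
      by (intro add_left_mono mult_left_mono B) auto
    finally show ?thesis using that by (simp add: q_def field_simps)
  qed
  have "((\<lambda>y. norm (f y *\<^sub>R g y - f x *\<^sub>R g x - f x *\<^sub>R g' (y - x)) / norm (y - x)) \<longlongrightarrow> 0) (at x)"
    by (rule tendsto_sandwich[OF _ _ tendsto_const lim]) (auto simp: eventually_at_filter intro!: always_eventually bnd)
  thus ?thesis unfolding has_derivative_iff_norm
    using bounded_linear_scaleR_right bl bounded_linear_compose by blast
qed

text \<open>With \<open>S\<close> the inverse of \<open>T x\<close> and \<open>E y = T y - T x\<close>, a solution satisfies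
\<open>s y = S c - S (E y (s y))\<close>. First this shows that \<open>s\<close> is continuous at \<open>x\<close>; expanding \<open>E y (s y)\<close> in
a basis then writes \<open>s\<close> through products of a continuous factor and a differentiable one vanishing at
\<open>x\<close>.\<close>

lemma differentiable_solution_of_linear_system:
  fixes T :: "'m::real_normed_vector \<Rightarrow> 'a::euclidean_space \<Rightarrow> 'a"
  assumes V: "open V" "x \<in> V" and lin: "\<And>y. y \<in> V \<Longrightarrow> linear (T y)"
    and der: "\<And>v. ((\<lambda>y. T y v) has_derivative T' v) (at x)" and inj: "inj (T x)"
  obtains s where "\<forall>\<^sub>F y in nhds x. T y (s y) = c" "s differentiable (at x)"
proof -
  have linx: "linear (T x)" using lin V by blast
  obtain S where S: "linear S" "S \<circ> T x = id" using linear_injective_left_inverse[OF linx inj] by blast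
  have ST: "S (T x v) = v" for v using S(2) by (metis comp_apply id_apply)
  obtain K where K: "K > 0" "\<And>w. norm (S w) \<le> K * norm w" using linear_bounded_pos[OF S(1)] by blast
  define E where "E y v = T y v - T x v" for y v
  define \<epsilon> where "\<epsilon> y = (\<Sum>b\<in>Basis. norm (E y b))" for y
  have linE: "linear (E y)" if "y \<in> V" for y
    unfolding E_def using linear_compose_sub[OF lin[OF that] linx] .
  have Tlim: "((\<lambda>y. T y v) \<longlongrightarrow> T x v) (nhds x)" for v
    using has_derivative_continuous[OF der[of v]] by (simp add: tendsto_nhds_iff continuous_at)
  have "(\<epsilon> \<longlongrightarrow> (\<Sum>b\<in>(Basis::'a set). norm (T x b - T x b))) (nhds x)"
    unfolding \<epsilon>_def E_def by (intro tendsto_intros Tlim)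
  hence \<epsilon>: "(\<epsilon> \<longlongrightarrow> 0) (nhds x)" by simp
  have "((\<lambda>y. K * \<epsilon> y) \<longlongrightarrow> 0) (nhds x)" using tendsto_mult_left[OF \<epsilon>, of K] by simp
  hence "\<forall>\<^sub>F y in nhds x. K * \<epsilon> y < 1/2" by (rule order_tendstoD) simp
  moreover have "\<forall>\<^sub>F y in nhds x. y \<in> V" using V by (rule eventually_nhds_in_open)
  ultimately have good: "\<forall>\<^sub>F y in nhds x. y \<in> V \<and> K * \<epsilon> y < 1/2" by (simp add: eventually_conj_iff)
  have below: "norm v \<le> 2 * K * norm (T y v)" if "y \<in> V \<and> K * \<epsilon> y < 1/2" for y v
  proof -
    have "T x v = T y v - E y v" by (simp add: E_def)
    hence "v = S (T y v) - S (E y v)" using ST[of v] linear_diff[OF S(1)] by metis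
    hence "norm v \<le> norm (S (T y v)) + norm (S (E y v))" by (metis norm_triangle_ineq4)
    also have "\<dots> \<le> K * norm (T y v) + K * (\<epsilon> y * norm v)"
      using linear_norm_le_basis[OF linE, of y v] that K(1)
      by (intro add_mono order_trans[OF K(2)] mult_left_mono) (auto simp: \<epsilon>_def)
    also have "K * (\<epsilon> y * norm v) \<le> 1/2 * norm v"
      using that mult_right_mono[of "K * \<epsilon> y" "1/2" "norm v"] by (simp add: mult.assoc)
    finally show ?thesis by simp
  qed
  define s where "s y = inv (T y) c" for y
  have sol: "T y (s y) = c" if y: "y \<in> V \<and> K * \<epsilon> y < 1/2" for y
  proof -
    have "v = 0" if "T y v = 0" for v using below[OF y, of v] that by simp
    hence "inj (T y)" using lin y by (auto simp: linear_injective_0)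
    hence "surj (T y)" using linear_inj_imp_surj lin y by blast
    thus ?thesis unfolding s_def by (rule surj_f_inv_f)
  qed
  have \<epsilon>x: "\<epsilon> x = 0" by (simp add: \<epsilon>_def E_def)
  have goodx: "x \<in> V \<and> K * \<epsilon> x < 1/2" using V \<epsilon>x by simp
  have sx: "s x = S c" using ST[of "s x"] sol[OF goodx] by simp
  have fix_eq: "s y = S c - S (E y (s y))" if "y \<in> V \<and> K * \<epsilon> y < 1/2" for y
    using ST[of "s y"] sol[OF that] linear_diff[OF S(1)] by (simp add: E_def)
  have "norm (s y - s x) \<le> \<epsilon> y * (K * (2 * K * norm c))" if y: "y \<in> V \<and> K * \<epsilon> y < 1/2" for y
  proof -
    have "norm (s y - s x) = norm (S (E y (s y)))" using fix_eq[OF y] sx by (metis add_diff_cancel_left' diff_diff_eq2 norm_minus_commute)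
    also have "\<dots> \<le> K * (\<epsilon> y * norm (s y))"
      using linear_norm_le_basis[OF linE, of y "s y"] y K(1)
      by (intro order_trans[OF K(2)] mult_left_mono) (auto simp: \<epsilon>_def)
    also have "\<dots> \<le> K * (\<epsilon> y * (2 * K * norm c))"
      using below[OF y, of "s y"] sol[OF y] K(1) by (intro mult_left_mono) (auto simp: \<epsilon>_def sum_nonneg)
    finally show ?thesis by (simp add: mult_ac)
  qed
  hence "\<forall>\<^sub>F y in nhds x. norm (s y - s x) \<le> \<epsilon> y * (K * (2 * K * norm c))"
    by (intro eventually_mono[OF good])
  hence "((\<lambda>y. s y - s x) \<longlongrightarrow> 0) (nhds x)"
    by (rule Lim_null_comparison) (use tendsto_mult_right[OF \<epsilon>] in simp)
  hence "(s \<longlongrightarrow> s x) (nhds x)" by (simp add: LIM_zero_iff)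
  hence scont: "(s \<longlongrightarrow> s x) (at x)" by (simp add: tendsto_nhds_iff)
  have blS: "bounded_linear S" using S(1) by (simp add: linear_conv_bounded_linear)
  have SE: "((\<lambda>y. S (E y b)) has_derivative (\<lambda>h. S (T' b h - 0))) (at x)" for b
    unfolding E_def
    by (rule bounded_linear.has_derivative[OF blS])
      (intro has_derivative_diff der has_derivative_const)
  have SE0: "S (E x b) = 0" for b by (simp add: E_def linear_0[OF S(1)])
  have "((\<lambda>y. (s y \<bullet> b) *\<^sub>R S (E y b)) has_derivative (\<lambda>h. (s x \<bullet> b) *\<^sub>R S (T' b h - 0))) (at x)" for b
    by (rule has_derivative_scaleR_vanishing[OF _ SE SE0]) (intro tendsto_intros scont)
  hence "((\<lambda>y. S c - (\<Sum>b\<in>Basis. (s y \<bullet> b) *\<^sub>R S (E y b))) has_derivative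
      (\<lambda>h. 0 - (\<Sum>b\<in>Basis. (s x \<bullet> b) *\<^sub>R S (T' b h - 0)))) (at x)"
    by (intro has_derivative_diff has_derivative_sum has_derivative_const)
  moreover have expand: "S c - (\<Sum>b\<in>Basis. (s y \<bullet> b) *\<^sub>R S (E y b)) = s y"
    if y: "y \<in> V \<and> K * \<epsilon> y < 1/2" for y
  proof -
    have "linear (S \<circ> E y)" using linE S y by (blast intro: linear_compose)
    hence "(S \<circ> E y) (\<Sum>b\<in>Basis. (s y \<bullet> b) *\<^sub>R b) = (\<Sum>b\<in>Basis. (s y \<bullet> b) *\<^sub>R (S \<circ> E y) b)"
      by (simp only: linear_sum linear_cmul)
    thus ?thesis using fix_eq[OF y] by (simp add: euclidean_representation)
  qed
  ultimately have "(s has_derivative (\<lambda>h. 0 - (\<Sum>b\<in>Basis. (s x \<bullet> b) *\<^sub>R S (T' b h - 0)))) (at x)"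
    using good goodx
    by (elim has_derivative_transform_eventually) (auto simp: eventually_at_filter elim: eventually_mono)
  hence "s differentiable (at x)" unfolding differentiable_def by blast
  moreover have "\<forall>\<^sub>F y in nhds x. T y (s y) = c" by (rule eventually_mono[OF good]) (rule sol)
  ultimately show thesis using that by blast
qed


lemma unit_vectors_parallel:
  fixes u w :: "'a::real_inner"
  assumes "norm u = 1" "norm w = 1" "u \<bullet> w = 1 \<or> u \<bullet> w = -1"
  shows "u = w \<or> u = - w"
proof -
  have "(u - w) \<bullet> (u - w) = 2 - 2 * (u \<bullet> w)" "(u + w) \<bullet> (u + w) = 2 + 2 * (u \<bullet> w)"
    using assms(1,2) unfolding norm_eq_1
    by (simp_all add: inner_diff_left inner_diff_right inner_add_left inner_add_right
        inner_commute del: dot_square_norm)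
  hence "(u - w) \<bullet> (u - w) = 0 \<or> (u + w) \<bullet> (u + w) = 0" using assms(3) by auto
  thus ?thesis unfolding inner_eq_zero_iff by (simp add: eq_neg_iff_add_eq_0)
qed

lemma orthogonal_comp_range_line:
  fixes L :: "'m::euclidean_space \<Rightarrow> 'a::euclidean_space"
  assumes L: "linear L" "inj L" and dim: "DIM('a) = DIM('m) + 1"
  shows "subspace ((range L)\<^sup>\<bottom>)" "dim ((range L)\<^sup>\<bottom>) = 1"
proof -
  show "subspace ((range L)\<^sup>\<bottom>)" by (rule subspace_orthogonal_comp)
  have "dim (range L) = DIM('m)" using dim_image_eq[OF L(1), of UNIV] L(2) by (simp add: inj_on_def)
  moreover have "dim {y \<in> UNIV. \<forall>x\<in>range L. orthogonal x y} + dim (range L) = dim (UNIV::'a set)"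
    by (rule dim_subspace_orthogonal_to_vectors) (auto intro: linear_subspace_image[OF L(1)])
  ultimately show "dim ((range L)\<^sup>\<bottom>) = 1" using dim by (simp add: orthogonal_comp_def)
qed

lemma unit_normal_spans:
  fixes L :: "'m::euclidean_space \<Rightarrow> 'a::euclidean_space"
  assumes L: "linear L" "inj L" and dim: "DIM('a) = DIM('m) + 1"
    and \<nu>: "\<nu> \<in> (range L)\<^sup>\<bottom>" "norm \<nu> = 1" and w: "w \<in> (range L)\<^sup>\<bottom>"
  shows "w = (w \<bullet> \<nu>) *\<^sub>R \<nu>"
proof (rule ccontr)
  note N = orthogonal_comp_range_line[OF L dim]
  define z where "z = w - (w \<bullet> \<nu>) *\<^sub>R \<nu>"
  assume "w \<noteq> (w \<bullet> \<nu>) *\<^sub>R \<nu>"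
  hence z: "z \<noteq> 0" by (simp add: z_def)
  have \<nu>\<nu>: "\<nu> \<bullet> \<nu> = 1" using \<nu>(2) by (simp add: dot_square_norm)
  have z\<nu>: "z \<bullet> \<nu> = 0" by (simp add: z_def inner_diff_left \<nu>\<nu>)
  hence ne: "z \<noteq> \<nu>" using \<nu>\<nu> by auto
  have "pairwise orthogonal {z, \<nu>}"
    using z\<nu> by (auto simp: pairwise_insert orthogonal_def inner_commute)
  hence "independent {z, \<nu>}" using z \<nu>(2) by (intro pairwise_orthogonal_independent) auto
  moreover have "{z, \<nu>} \<subseteq> (range L)\<^sup>\<bottom>"
    using N(1) \<nu>(1) w by (auto simp: z_def intro: subspace_diff subspace_scale)
  ultimately have "card {z, \<nu>} \<le> dim ((range L)\<^sup>\<bottom>)" using independent_card_le_dim by blast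
  thus False using N(2) ne by simp
qed

lemma unit_normal_exists:
  fixes L :: "'m::euclidean_space \<Rightarrow> 'a::euclidean_space"
  assumes L: "linear L" "inj L" and dim: "DIM('a) = DIM('m) + 1"
  shows "\<exists>\<nu>. \<nu> \<in> (range L)\<^sup>\<bottom> \<and> norm \<nu> = 1"
proof -
  note N = orthogonal_comp_range_line[OF L dim]
  have "\<not> (range L)\<^sup>\<bottom> \<subseteq> {0}" using N(2) dim_eq_0[of "(range L)\<^sup>\<bottom>"] by simp
  then obtain w where w: "w \<in> (range L)\<^sup>\<bottom>" "w \<noteq> 0" by auto
  thus ?thesis using N(1) by (intro exI[of _ "(1 / norm w) *\<^sub>R w"]) (simp add: subspace_scale)
qed

lemma mem_range_if_orthogonal_to_normal:
  fixes L :: "'m::euclidean_space \<Rightarrow> 'a::euclidean_space"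
  assumes L: "linear L" "inj L" and dim: "DIM('a) = DIM('m) + 1"
    and \<nu>: "\<nu> \<in> (range L)\<^sup>\<bottom>" "norm \<nu> = 1" and x: "x \<bullet> \<nu> = 0"
  shows "x \<in> range L"
proof -
  have "w \<bullet> x = 0" if "w \<in> (range L)\<^sup>\<bottom>" for w
    using unit_normal_spans[OF L dim \<nu> that] x by (metis inner_commute inner_scaleR_left mult_zero_right)
  hence "x \<in> ((range L)\<^sup>\<bottom>)\<^sup>\<bottom>"
    unfolding orthogonal_comp_def[of "(range L)\<^sup>\<bottom>"] by (simp add: orthogonal_def)
  thus ?thesis using orthogonal_comp_self[OF linear_subspace_image[OF L(1) subspace_UNIV]] by simp
qed

lemma orthogonal_to_range_if_basis:
  fixes L :: "'m::euclidean_space \<Rightarrow> 'a::real_inner"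
  assumes "linear L" "\<And>b. b \<in> Basis \<Longrightarrow> v \<bullet> L b = 0"
  shows "v \<bullet> L w = 0"
proof -
  have "v \<bullet> L (\<Sum>b\<in>Basis. (w \<bullet> b) *\<^sub>R b) = 0"
    using assms by (simp add: linear_sum linear_cmul inner_sum_right)
  thus ?thesis by (simp add: euclidean_representation)
qed

text \<open>Normal vectors \<open>v\<close> near \<open>\<nu>\<close>, scaled so that \<open>v \<bullet> \<nu> = 1\<close>, solve the linear system
\<open>v \<bullet> D y b = 0\<close>. Packing the equations along the basis \<open>D x b\<close>, \<open>\<nu>\<close> of the ambient space turns it into
\<open>T y v = \<nu>\<close> with an endomorphism \<open>T y\<close> that is positive definite for \<open>y = x\<close>.\<close>

lemma differentiable_unit_normal_field:
  fixes D :: "'m::euclidean_space \<Rightarrow> 'm \<Rightarrow> 'a::euclidean_space"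
  assumes V: "open V" "x \<in> V" and lin: "\<And>y. y \<in> V \<Longrightarrow> linear (D y)"
    and der: "\<And>v. ((\<lambda>y. D y v) has_derivative D2 v) (at x)" and inj: "inj (D x)"
    and dim: "DIM('a) = DIM('m) + 1"
    and \<nu>: "\<nu> \<in> (range (D x))\<^sup>\<bottom>" "norm \<nu> = 1"
  obtains N where "\<forall>\<^sub>F y in nhds x. N y \<in> (range (D y))\<^sup>\<bottom> \<and> norm (N y) = 1"
    "N differentiable (at x)" "N x = \<nu>"
proof -
  note linx = lin[OF V(2)]
  have \<nu>\<nu>: "\<nu> \<bullet> \<nu> = 1" using \<nu>(2) by (simp add: dot_square_norm)
  have D\<nu>: "D x v \<bullet> \<nu> = 0" for v using \<nu>(1) by (auto simp: orthogonal_comp_def orthogonal_def)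
  \<comment> \<open>Pairing \<open>T y v = \<nu>\<close> with \<open>\<nu>\<close> gives \<open>v \<bullet> \<nu> = 1\<close>; injectivity of \<open>D x\<close> then gives the other equations.\<close>
  define T where "T y v = (\<Sum>b\<in>Basis. (v \<bullet> D y b) *\<^sub>R D x b) + (v \<bullet> \<nu>) *\<^sub>R \<nu>" for y v
  have Tlin: "linear (T y)" for y
    by (rule linearI) (simp_all add: T_def inner_left_distrib scaleR_left_distrib sum.distrib
        scaleR_sum_right scaleR_right_distrib)
  have Tder: "((\<lambda>y. T y v) has_derivative (\<lambda>h. (\<Sum>b\<in>Basis. (v \<bullet> D2 b h) *\<^sub>R D x b) + 0)) (at x)" for v
    unfolding T_def
    by (intro has_derivative_add has_derivative_sum has_derivative_scaleR_left
        has_derivative_inner_right der has_derivative_const)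
  have "v = 0" if "T x v = 0" for v
  proof -
    have "v \<bullet> T x v = (\<Sum>b\<in>Basis. (v \<bullet> D x b)\<^sup>2) + (v \<bullet> \<nu>)\<^sup>2"
      by (simp add: T_def inner_right_distrib inner_sum_right power2_eq_square)
    hence "(\<Sum>b\<in>Basis. (v \<bullet> D x b)\<^sup>2) + (v \<bullet> \<nu>)\<^sup>2 = 0" using that by simp
    moreover have "(\<Sum>b\<in>(Basis::'m set). (v \<bullet> D x b)\<^sup>2) \<ge> 0" by (intro sum_nonneg) auto
    ultimately have z: "(\<Sum>b\<in>(Basis::'m set). (v \<bullet> D x b)\<^sup>2) = 0" "(v \<bullet> \<nu>)\<^sup>2 = 0"
      using zero_le_power2[of "v \<bullet> \<nu>"] by linarith+
    hence "v \<bullet> D x b = 0" if "b \<in> Basis" for b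
      using that by (simp add: sum_nonneg_eq_0_iff)
    hence "v \<bullet> D x w = 0" for w by (rule orthogonal_to_range_if_basis[OF linx])
    hence "v \<in> (range (D x))\<^sup>\<bottom>"
      by (auto simp: orthogonal_comp_def orthogonal_def inner_commute)
    from unit_normal_spans[OF linx inj dim \<nu> this] z(2) show ?thesis by simp
  qed
  hence Tinj: "inj (T x)" using Tlin by (simp add: linear_injective_0)
  obtain s where s: "\<forall>\<^sub>F y in nhds x. T y (s y) = \<nu>" "s differentiable (at x)"
    using differentiable_solution_of_linear_system[OF V Tlin Tder Tinj, of \<nu>] by blast
  have key: "s y \<in> (range (D y))\<^sup>\<bottom> \<and> s y \<bullet> \<nu> = 1" if eq: "T y (s y) = \<nu>" and y: "y \<in> V" for y
  proof -
    have "T y (s y) \<bullet> \<nu> = s y \<bullet> \<nu>"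
      by (simp add: T_def inner_left_distrib inner_sum_left D\<nu> \<nu>\<nu>)
    hence 1: "s y \<bullet> \<nu> = 1" using eq \<nu>\<nu> by simp
    hence "(\<Sum>b\<in>Basis. (s y \<bullet> D y b) *\<^sub>R D x b) = 0" using eq by (simp add: T_def)
    hence "D x (\<Sum>b\<in>Basis. (s y \<bullet> D y b) *\<^sub>R b) = 0"
      using linx by (simp add: linear_sum linear_cmul)
    hence "(\<Sum>b\<in>Basis. (s y \<bullet> D y b) *\<^sub>R b) = 0"
      using inj linx linear_injective_0 by blast
    moreover have "(\<Sum>b\<in>Basis. (s y \<bullet> D y b) *\<^sub>R b) \<bullet> b = s y \<bullet> D y b" if "b \<in> Basis" for b
      using that by (simp add: inner_sum_left inner_Basis if_distrib[of "(*) _"] cong: if_cong)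
    ultimately have "s y \<bullet> D y b = 0" if "b \<in> Basis" for b
      using that by (metis inner_zero_left)
    hence "s y \<bullet> D y v = 0" for v by (rule orthogonal_to_range_if_basis[OF lin[OF y]])
    thus ?thesis using 1 by (auto simp: orthogonal_comp_def orthogonal_def inner_commute)
  qed
  define N where "N y = (1 / norm (s y)) *\<^sub>R s y" for y
  have sx: "s x = \<nu>"
  proof -
    have "T x (s x) = \<nu>" using s(1) by (rule eventually_nhds_x_imp_x)
    from key[OF this V(2)] unit_normal_spans[OF linx inj dim \<nu>, of "s x"] show ?thesis by simp
  qed
  have "\<forall>\<^sub>F y in nhds x. y \<in> V" using V by (rule eventually_nhds_in_open)
  with s(1) have "\<forall>\<^sub>F y in nhds x. N y \<in> (range (D y))\<^sup>\<bottom> \<and> norm (N y) = 1"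
  proof eventually_elim
    case (elim y)
    from key[OF this] have "s y \<noteq> 0" "s y \<in> (range (D y))\<^sup>\<bottom>" by auto
    thus ?case using subspace_scale[OF subspace_orthogonal_comp] by (auto simp: N_def)
  qed
  moreover have "N differentiable (at x)"
  proof -
    have "s x \<noteq> 0" using sx \<nu>(2) by auto
    hence "(norm \<circ> s) differentiable (at x)"
      by (intro differentiable_chain_at s(2) differentiable_norm_at)
    hence "(\<lambda>y. 1 / norm (s y)) differentiable (at x)"
      using \<open>s x \<noteq> 0\<close> by (intro differentiable_divide differentiable_const) (auto simp: o_def)
    thus ?thesis unfolding N_def by (rule differentiable_scaleR[OF _ s(2)])
  qed
  moreover have "N x = \<nu>" using sx \<nu>(2) by (simp add: N_def)
  ultimately show thesis using that by blast
qed

section \<open>Hypersurfaces in coordinates\<close>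

lemma derivative_zero_if_eventually_const:
  fixes f :: "'m::real_normed_vector \<Rightarrow> 'b::real_normed_vector"
  assumes f: "(f has_derivative f') (at x)" and c: "\<forall>\<^sub>F y in nhds x. f y = k"
  shows "f' h = 0"
proof -
  have "((\<lambda>_. k) has_derivative f') (at x)"
    using has_derivative_transform_eventually[OF f, of "\<lambda>_. k"] c eventually_nhds_x_imp_x[OF c]
    by (simp add: eventually_nhds_conv_at)
  from has_derivative_unique[OF this has_derivative_const] show ?thesis by simp
qed

text \<open>The sublevel sets of \<open>norm \<circ> F\<close> are compact. The maximizer also maximizes \<open>\<phi>\<close> over its own, possibly
smaller, sublevel set; this is the form that can be contradicted by moving inward.\<close>

lemma maximizer_on_sublevel:
  fixes F :: "'p::topological_space \<Rightarrow> 'a::euclidean_space" and \<phi> :: "'p \<Rightarrow> real"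
  assumes proper: "properly_immersed M F" and \<phi>: "continuous_on M \<phi>" and p0: "p0 \<in> M"
  obtains q where "q \<in> M" "norm (F q) \<le> norm (F p0)" "\<phi> p0 \<le> \<phi> q"
    "\<And>p. p \<in> M \<Longrightarrow> norm (F p) \<le> norm (F q) \<Longrightarrow> \<phi> p \<le> \<phi> q"
proof -
  let ?K = "{p \<in> M. F p \<in> cball 0 (norm (F p0))}"
  have K: "compact ?K"
    by (rule proper[unfolded properly_immersed_def, rule_format, OF compact_cball])
  have p0K: "p0 \<in> ?K" using p0 by simp
  hence ne: "?K \<noteq> {}" by auto
  have "continuous_on ?K \<phi>" using \<phi> by (rule continuous_on_subset) auto
  from continuous_attains_sup[OF K ne this] obtain q
    where q: "q \<in> ?K" and max: "\<forall>p\<in>?K. \<phi> p \<le> \<phi> q" by (elim bexE)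
  show thesis
  proof (rule that[of q])
    show "\<phi> p \<le> \<phi> q" if "p \<in> M" "norm (F p) \<le> norm (F q)" for p
      using max that q by simp
  qed (use q max p0K in auto)
qed

locale hypersurface =
  fixes M :: "'p::{t2_space, second_countable_topology} set"
    and \<A> :: "('p, 'm::euclidean_space) chart set"
    and F :: "'p \<Rightarrow> 'a::euclidean_space"
  assumes immersed: "immersed_hypersurface M \<A> F"
begin

definition coords :: "('p, 'm) chart \<Rightarrow> 'm set" where "coords c = snd c ` fst c"
definition local_map :: "('p, 'm) chart \<Rightarrow> 'm \<Rightarrow> 'a" where "local_map c = F \<circ> param c"
definition D :: "('p, 'm) chart \<Rightarrow> 'm \<Rightarrow> 'm \<Rightarrow> 'a" where
  "D c y = frechet_derivative (local_map c) (at y)"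
definition D2 :: "('p, 'm) chart \<Rightarrow> 'm \<Rightarrow> 'm \<Rightarrow> 'm \<Rightarrow> 'a" where
  "D2 c w y = frechet_derivative (\<lambda>y. D c y w) (at y)"

lemma dim: "DIM('a) = DIM('m) + 1"
  and connected: "connected M" and nonempty: "M \<noteq> {}"
  using immersed unfolding immersed_hypersurface_def by auto

lemma chart_at:
  assumes "p \<in> M"
  obtains c where "c \<in> \<A>" "p \<in> fst c"
  using assms immersed unfolding immersed_hypersurface_def smooth_atlas_def by blast

context
  fixes c assumes c: "c \<in> \<A>"
begin

lemma is_chart: "is_chart M c"
  using c immersed unfolding immersed_hypersurface_def smooth_atlas_def by blast

lemma open_coords: "open (coords c)"
  using is_chart unfolding is_chart_def coords_def by blast

lemma chart_openin: "openin (top_of_set M) (fst c)"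
  using is_chart unfolding is_chart_def by blast

lemma chart_subset: "fst c \<subseteq> M"
  using openin_imp_subset[OF chart_openin] .

lemma chart_homeomorphism: "homeomorphism (fst c) (coords c) (snd c) (param c)"
  using is_chart unfolding is_chart_def coords_def by blast

lemma snd_in_coords: "p \<in> fst c \<Longrightarrow> snd c p \<in> coords c" unfolding coords_def by blast

lemma param_snd: "p \<in> fst c \<Longrightarrow> param c (snd c p) = p"
  and snd_param: "y \<in> coords c \<Longrightarrow> snd c (param c y) = y"
  and param_in: "y \<in> coords c \<Longrightarrow> param c y \<in> fst c"
  using chart_homeomorphism unfolding homeomorphism_def by auto

lemma tendsto_chart:
  assumes p: "p \<in> fst c"
  shows "(snd c \<longlongrightarrow> snd c p) (at p within M)" and "\<forall>\<^sub>F q in at p within M. q \<in> fst c"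
proof -
  obtain O' where O': "open O'" "fst c = M \<inter> O'" using chart_openin by (auto simp: openin_open)
  have eq: "at p within M = at p within fst c"
    by (rule at_within_nhd[of p O']) (use p O' in auto)
  have "continuous_on (fst c) (snd c)" using chart_homeomorphism unfolding homeomorphism_def by blast
  thus "(snd c \<longlongrightarrow> snd c p) (at p within M)" using p unfolding eq continuous_on_def by blast
  show "\<forall>\<^sub>F q in at p within M. q \<in> fst c" unfolding eq by (simp add: eventually_at_filter)
qed

lemma Ck: "Ck_on k (coords c) (local_map c)"
  using c immersed
  unfolding immersed_hypersurface_def smooth_immersion_def smooth_on_def coords_def local_map_def by blast

lemma dir_deriv_eq: "dir_deriv c F p = D c (snd c p)"
  by (rule ext) (simp add: dir_deriv_def D_def local_map_def)

lemma inj_D: "p \<in> fst c \<Longrightarrow> inj (D c (snd c p))"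
  using c immersed dir_deriv_eq
  unfolding immersed_hypersurface_def smooth_immersion_def by metis

lemma D: "y \<in> coords c \<Longrightarrow> (local_map c has_derivative D c y) (at y)"
  using Ck[of "Suc 0"] frechet_derivative_works unfolding D_def by auto

lemma D2: "y \<in> coords c \<Longrightarrow> ((\<lambda>y. D c y w) has_derivative D2 c w y) (at y)"
proof -
  assume "y \<in> coords c"
  hence "(\<lambda>y. D c y w) differentiable (at y)" using Ck[of "Suc (Suc 0)"] unfolding D_def by simp
  thus ?thesis unfolding D2_def using frechet_derivative_works by blast
qed

lemma continuous_D2: "continuous_on (coords c) (\<lambda>y. D2 c u y v)"
  using Ck[of "Suc (Suc 0)"] unfolding D_def D2_def by auto

lemma continuous_D: "continuous_on (coords c) (\<lambda>y. D c y v)"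
  using Ck[of "Suc 0"] unfolding D_def by auto

lemma linear_D: "y \<in> coords c \<Longrightarrow> linear (D c y)"
  using has_derivative_linear[OF D] .

lemma D2_commute: "y \<in> coords c \<Longrightarrow> D2 c u y v = D2 c v y u"
  by (rule mixed_derivatives_commute[OF open_coords _ D D2 continuous_D2])

lemma tangent_space_eq: "tangent_space c F p = range (D c (snd c p))"
  by (simp add: tangent_space_def dir_deriv_eq)

lemma local_map_eq: "y \<in> coords c \<Longrightarrow> local_map c y = F (param c y)"
  by (simp add: local_map_def)

lemma second_ff_coords:
  assumes p: "p \<in> fst c"
  shows "second_ff c F p (D c (snd c p) u) (D c (snd c p) w) = normal_part c F p (D2 c w (snd c p) u)"
proof -
  have y: "snd c p \<in> coords c" using p by (rule snd_in_coords)
  have "((\<lambda>_. w) \<circ> param c) differentiable (at (snd c p))" by (simp add: o_def)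
  from second_ff_extension[OF immersed c p _ this, of "\<lambda>q. dir_deriv c F q w"]
  have "second_ff c F p (D c (snd c p) u) (D c (snd c p) w)
      = normal_part c F p (dir_deriv c (\<lambda>q. dir_deriv c F q w) p u)"
    by (simp add: dir_deriv_eq)
  moreover have "(((\<lambda>q. dir_deriv c F q w) \<circ> param c) has_derivative D2 c w (snd c p)) (at (snd c p))"
    by (rule has_derivative_transform_within_open[OF D2[OF y] open_coords y])
      (simp add: dir_deriv_eq snd_param)
  hence "dir_deriv c (\<lambda>q. dir_deriv c F q w) p = D2 c w (snd c p)"
    unfolding dir_deriv_def[of c "\<lambda>q. dir_deriv c F q w"] using frechet_derivative_at by metis
  ultimately show ?thesis by simp
qed

lemma parts_in_terms_of_normal:
  assumes p: "p \<in> fst c" and \<nu>: "unit_normal c F p \<nu>"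
  shows "tangent_part c F p x = x - (x \<bullet> \<nu>) *\<^sub>R \<nu>" and "normal_part c F p x = (x \<bullet> \<nu>) *\<^sub>R \<nu>"
proof -
  note L = linear_D[OF snd_in_coords[OF p]] inj_D[OF p]
  have \<nu>': "\<nu> \<in> (range (D c (snd c p)))\<^sup>\<bottom>" "norm \<nu> = 1"
    using \<nu> unfolding unit_normal_def tangent_space_eq by auto
  have "\<nu> \<bullet> \<nu> = 1" using \<nu>'(2) by (simp add: dot_square_norm)
  hence "(x - (x \<bullet> \<nu>) *\<^sub>R \<nu>) \<bullet> \<nu> = 0" by (simp add: inner_diff_left)
  from mem_range_if_orthogonal_to_normal[OF L dim \<nu>' this]
  have "x - (x \<bullet> \<nu>) *\<^sub>R \<nu> \<in> tangent_space c F p" by (simp add: tangent_space_eq)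
  moreover have "x - (x - (x \<bullet> \<nu>) *\<^sub>R \<nu>) \<in> (tangent_space c F p)\<^sup>\<bottom>"
    using subspace_scale[OF subspace_orthogonal_comp \<nu>'(1)] by (simp add: tangent_space_eq)
  ultimately show t: "tangent_part c F p x = x - (x \<bullet> \<nu>) *\<^sub>R \<nu>"
    by (intro tangent_part_eqI) (simp_all add: dir_deriv_eq L(1))
  show "normal_part c F p x = (x \<bullet> \<nu>) *\<^sub>R \<nu>" by (simp add: normal_part_def t)
qed

lemma local_unit_normal_field:
  assumes p: "p \<in> fst c" and \<nu>: "unit_normal c F p \<nu>"
  obtains N N' where "\<forall>\<^sub>F y in nhds (snd c p). y \<in> coords c \<and> unit_normal c F (param c y) (N y)"
    "(N has_derivative N') (at (snd c p))" "N (snd c p) = \<nu>"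
proof -
  note y = snd_in_coords[OF p]
  have \<nu>': "\<nu> \<in> (range (D c (snd c p)))\<^sup>\<bottom>" "norm \<nu> = 1"
    using \<nu> unfolding unit_normal_def tangent_space_eq by auto
  obtain N where N: "\<forall>\<^sub>F y in nhds (snd c p). N y \<in> (range (D c y))\<^sup>\<bottom> \<and> norm (N y) = 1"
    "N differentiable (at (snd c p))" "N (snd c p) = \<nu>"
    using differentiable_unit_normal_field[OF open_coords y linear_D D2[OF y] inj_D[OF p] dim \<nu>'] by blast
  have "\<forall>\<^sub>F y in nhds (snd c p). y \<in> coords c" using open_coords y by (rule eventually_nhds_in_open)
  with N(1) have "\<forall>\<^sub>F y in nhds (snd c p). y \<in> coords c \<and> unit_normal c F (param c y) (N y)"
    by eventually_elim (simp add: unit_normal_def tangent_space_eq snd_param)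
  thus thesis using N(2,3) that unfolding differentiable_def by blast
qed

text \<open>The Weingarten equations, from differentiating \<open>N \<bullet> N = 1\<close> and \<open>D v \<bullet> N = 0\<close>.\<close>

lemma derivative_of_normal_field:
  assumes p: "p \<in> fst c"
    and N: "\<forall>\<^sub>F y in nhds (snd c p). y \<in> coords c \<and> unit_normal c F (param c y) (N y)"
    and N': "(N has_derivative N') (at (snd c p))"
  shows "N' u \<bullet> N (snd c p) = 0"
    and "D c (snd c p) v \<bullet> N' u = - (D2 c v (snd c p) u \<bullet> N (snd c p))"
proof -
  note y = snd_in_coords[OF p]
  have "((\<lambda>y. N y \<bullet> N y) has_derivative (\<lambda>h. N (snd c p) \<bullet> N' h + N' h \<bullet> N (snd c p))) (at (snd c p))"
    by (intro has_derivative_inner N')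
  moreover have "\<forall>\<^sub>F y in nhds (snd c p). N y \<bullet> N y = 1"
    using N by eventually_elim (simp add: unit_normal_def dot_square_norm)
  ultimately have "N (snd c p) \<bullet> N' u + N' u \<bullet> N (snd c p) = 0"
    by (rule derivative_zero_if_eventually_const)
  thus "N' u \<bullet> N (snd c p) = 0" by (simp add: inner_commute)
  have "((\<lambda>y. D c y v \<bullet> N y) has_derivative
      (\<lambda>h. D c (snd c p) v \<bullet> N' h + D2 c v (snd c p) h \<bullet> N (snd c p))) (at (snd c p))"
    by (intro has_derivative_inner N' D2 y)
  moreover have "\<forall>\<^sub>F y in nhds (snd c p). D c y v \<bullet> N y = 0"
    using N by eventually_elim
      (auto simp: unit_normal_def tangent_space_eq snd_param orthogonal_comp_def orthogonal_def)
  ultimately have "D c (snd c p) v \<bullet> N' u + D2 c v (snd c p) u \<bullet> N (snd c p) = 0"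
    by (rule derivative_zero_if_eventually_const)
  thus "D c (snd c p) v \<bullet> N' u = - (D2 c v (snd c p) u \<bullet> N (snd c p))" by simp
qed

text \<open>If the \<open>w\<close>-derivative of \<open>\<phi>\<close> were negative, a small step in direction \<open>-w\<close> would raise \<open>\<phi>\<close> while
lowering \<open>norm (F p)\<close>, against the choice of \<open>q\<close>.\<close>

lemma no_inward_increase:
  assumes q: "q \<in> fst c" and max: "\<And>p. p \<in> M \<Longrightarrow> norm (F p) \<le> norm (F q) \<Longrightarrow> \<phi> p \<le> (\<phi> q :: real)"
    and \<psi>: "(\<psi> has_derivative \<psi>') (at (snd c q))" "\<forall>\<^sub>F y in nhds (snd c q). \<phi> (param c y) = \<psi> y"
    and w: "F q \<bullet> D c (snd c q) w > 0"
  shows "\<psi>' w \<ge> 0"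
proof (rule ccontr)
  assume "\<not> \<psi>' w \<ge> 0"
  hence neg: "\<psi>' w < 0" by simp
  define y0 where "y0 = snd c q"
  have y0: "y0 \<in> coords c" unfolding y0_def using q by (rule snd_in_coords)
  have Gy0: "local_map c y0 = F q" using local_map_eq[OF y0] param_snd[OF q] by (simp add: y0_def)
  have \<psi>y0: "\<psi> y0 = \<phi> q" using eventually_nhds_x_imp_x[OF \<psi>(2)] param_snd[OF q] by (simp add: y0_def)
  have "((\<lambda>s. \<psi> (y0 + s *\<^sub>R w)) has_real_derivative \<psi>' w) (at 0)"
    by (rule has_real_derivative_along_line) (use \<psi>(1) in \<open>simp add: y0_def\<close>)
  from DERIV_neg_dec_left[OF this neg] obtain d1 where d1: "d1 > 0"
    "\<And>h. 0 < h \<Longrightarrow> h < d1 \<Longrightarrow> \<psi> y0 < \<psi> (y0 + (- h) *\<^sub>R w)" by auto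
  have "((\<lambda>y. local_map c y \<bullet> local_map c y) has_derivative
      (\<lambda>h. local_map c y0 \<bullet> D c y0 h + D c y0 h \<bullet> local_map c y0)) (at y0)"
    by (intro has_derivative_inner D y0)
  hence "((\<lambda>s. local_map c (y0 + s *\<^sub>R w) \<bullet> local_map c (y0 + s *\<^sub>R w)) has_real_derivative
      (local_map c y0 \<bullet> D c y0 w + D c y0 w \<bullet> local_map c y0)) (at 0)"
    by (intro has_real_derivative_along_line[where f = "\<lambda>y. local_map c y \<bullet> local_map c y"]) simp
  moreover have "local_map c y0 \<bullet> D c y0 w + D c y0 w \<bullet> local_map c y0 > 0"
    using w unfolding Gy0 by (simp add: inner_commute y0_def)
  ultimately obtain d2 where d2: "d2 > 0" "\<And>h. 0 < h \<Longrightarrow> h < d2 \<Longrightarrow>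
      local_map c (y0 + (- h) *\<^sub>R w) \<bullet> local_map c (y0 + (- h) *\<^sub>R w) < local_map c y0 \<bullet> local_map c y0"
    using DERIV_pos_inc_left by fastforce
  have "\<forall>\<^sub>F y in nhds y0. y \<in> coords c \<and> \<phi> (param c y) = \<psi> y"
    using \<psi>(2) eventually_nhds_in_open[OF open_coords y0] by (simp add: y0_def eventually_conj_iff)
  moreover have "((\<lambda>h. y0 + (- h) *\<^sub>R w) \<longlongrightarrow> y0 + (- 0) *\<^sub>R w) (at_right 0)"
    by (intro tendsto_intros)
  hence "((\<lambda>h. y0 + (- h) *\<^sub>R w) \<longlongrightarrow> y0) (at_right 0)" by simp
  ultimately have "\<forall>\<^sub>F h in at_right 0. y0 + (- h) *\<^sub>R w \<in> coords c \<and>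
      \<phi> (param c (y0 + (- h) *\<^sub>R w)) = \<psi> (y0 + (- h) *\<^sub>R w)"
    by (rule eventually_compose_filterlim)
  moreover have "\<forall>\<^sub>F h in at_right 0. h \<in> {0<..<min d1 d2}"
    using d1(1) d2(1) by (intro eventually_at_right_real) auto
  ultimately have "\<forall>\<^sub>F h in at_right (0::real). y0 + (- h) *\<^sub>R w \<in> coords c \<and>
      \<phi> (param c (y0 + (- h) *\<^sub>R w)) = \<psi> (y0 + (- h) *\<^sub>R w) \<and> h \<in> {0<..<min d1 d2}"
    by eventually_elim blast
  then obtain h where h: "y0 + (- h) *\<^sub>R w \<in> coords c" "0 < h" "h < d1" "h < d2"
    "\<phi> (param c (y0 + (- h) *\<^sub>R w)) = \<psi> (y0 + (- h) *\<^sub>R w)"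
    using eventually_happens[of _ "at_right (0::real)"] by (auto simp: trivial_limit_at_right_real)
  define p where "p = param c (y0 + (- h) *\<^sub>R w)"
  have "p \<in> M" using param_in[OF h(1)] chart_subset by (auto simp: p_def)
  moreover have "(norm (F p))\<^sup>2 < (norm (F q))\<^sup>2"
    using d2(2)[OF h(2,4)] local_map_eq[OF h(1)] Gy0 by (simp add: p_def dot_square_norm)
  hence "norm (F p) \<le> norm (F q)" by (meson less_imp_le norm_ge_zero power_less_imp_less_base)
  ultimately have "\<phi> p \<le> \<phi> q" by (rule max)
  thus False using d1(2)[OF h(2,3)] h(5) \<psi>y0 by (simp add: p_def)
qed

end

section \<open>The unit normal line\<close>

text \<open>The chain rule for the change of coordinates; exchanging the charts gives equality.\<close>

lemma tangent_space_subset_of_chart: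
  assumes c: "c \<in> \<A>" "p \<in> fst c" and d: "d \<in> \<A>" "p \<in> fst d"
  shows "tangent_space c F p \<subseteq> tangent_space d F p"
proof -
  define y where "y = snd c p"
  define \<tau> where "\<tau> = snd d \<circ> param c"
  let ?W = "snd c ` (fst c \<inter> fst d)"
  have "openin (top_of_set M) (fst c \<inter> fst d)" using chart_openin c d by (intro openin_Int) auto
  hence "openin (top_of_set (fst c)) (fst c \<inter> fst d)"
    by (rule openin_subset_trans) (use chart_subset c in auto)
  hence "openin (top_of_set (coords c)) ?W"
    by (rule homeomorphism_imp_open_map[OF chart_homeomorphism[OF c(1)]])
  hence W: "open ?W" using open_coords[OF c(1)] openin_open_eq by blast
  have yW: "y \<in> ?W" using c d by (auto simp: y_def)
  have "Ck_on (Suc 0) ?W \<tau>"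
    using immersed c d unfolding immersed_hypersurface_def smooth_atlas_def smooth_on_def \<tau>_def by blast
  hence "\<tau> differentiable (at y)" using yW unfolding Ck_on.simps by blast
  then obtain \<tau>' where \<tau>': "(\<tau> has_derivative \<tau>') (at y)" unfolding differentiable_def by blast
  have \<tau>y: "\<tau> y = snd d p" using param_snd[OF c] by (simp add: \<tau>_def y_def)
  have "(local_map d has_derivative D d (\<tau> y)) (at (\<tau> y))"
    unfolding \<tau>y by (rule D[OF d(1) snd_in_coords[OF d]])
  from has_derivative_compose[OF \<tau>' this]
  have "((\<lambda>z. local_map d (\<tau> z)) has_derivative (\<lambda>h. D d (\<tau> y) (\<tau>' h))) (at y)" .
  moreover have "local_map d (\<tau> z) = local_map c z" if z: "z \<in> ?W" for z
  proof -
    obtain x where x: "x \<in> fst c" "x \<in> fst d" "z = snd c x" using z by blast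
    show ?thesis
      by (simp add: local_map_def \<tau>_def x(3) param_snd[OF c(1) x(1)] param_snd[OF d(1) x(2)])
  qed
  ultimately have "(local_map c has_derivative (\<lambda>h. D d (\<tau> y) (\<tau>' h))) (at y)"
    using has_derivative_transform_within_open[OF _ W yW] by blast
  from has_derivative_unique[OF this D[OF c(1) snd_in_coords[OF c], folded y_def]]
  have eq: "D c y = (\<lambda>h. D d (\<tau> y) (\<tau>' h))" by simp
  have "range (D c y) \<subseteq> range (D d (\<tau> y))" unfolding eq by blast
  thus ?thesis unfolding \<tau>y by (simp add: tangent_space_eq[OF c(1)] tangent_space_eq[OF d(1)] y_def)
qed

lemma unit_normal_chart_independent:
  assumes "c \<in> \<A>" "p \<in> fst c" "d \<in> \<A>" "p \<in> fst d"
  shows "unit_normal c F p \<nu> \<longleftrightarrow> unit_normal d F p \<nu>"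
  using tangent_space_subset_of_chart[OF assms] tangent_space_subset_of_chart[OF assms(3,4,1,2)]
  unfolding unit_normal_def by (metis subset_antisym)

text \<open>A pointwise choice, in general discontinuous and possibly impossible to make continuous globally. Only
expressions that are even in the normal are formed from it.\<close>

definition normal :: "'p \<Rightarrow> 'a" where
  "normal p = (SOME \<nu>. \<forall>c\<in>\<A>. p \<in> fst c \<longrightarrow> unit_normal c F p \<nu>)"

lemma unit_normal_normal:
  assumes c: "c \<in> \<A>" "p \<in> fst c"
  shows "unit_normal c F p (normal p)"
proof -
  obtain \<nu> where "unit_normal c F p \<nu>"
    using unit_normal_exists[OF linear_D[OF c(1) snd_in_coords[OF c]] inj_D[OF c] dim]
    by (auto simp: unit_normal_def tangent_space_eq c(1))
  hence "\<forall>d\<in>\<A>. p \<in> fst d \<longrightarrow> unit_normal d F p \<nu>"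
    using unit_normal_chart_independent[OF c] by blast
  hence "\<forall>d\<in>\<A>. p \<in> fst d \<longrightarrow> unit_normal d F p (normal p)" unfolding normal_def by (rule someI)
  thus ?thesis using c by blast
qed

lemma unit_normal_eq_or_minus:
  assumes c: "c \<in> \<A>" "p \<in> fst c" and \<nu>: "unit_normal c F p \<nu>" and \<mu>: "unit_normal c F p \<mu>"
  shows "\<mu> = \<nu> \<or> \<mu> = - \<nu>"
proof -
  have eq: "\<mu> = (\<mu> \<bullet> \<nu>) *\<^sub>R \<nu>"
    using unit_normal_spans[OF linear_D[OF c(1) snd_in_coords[OF c]] inj_D[OF c] dim] \<nu> \<mu>
    by (simp add: unit_normal_def tangent_space_eq c(1))
  have "norm \<mu> = \<bar>\<mu> \<bullet> \<nu>\<bar> * norm \<nu>" by (subst eq) simp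
  hence "\<bar>\<mu> \<bullet> \<nu>\<bar> = 1" using \<nu> \<mu> by (simp add: unit_normal_def)
  hence "\<mu> \<bullet> \<nu> = 1 \<or> \<mu> \<bullet> \<nu> = -1" by linarith
  thus ?thesis using eq by (metis scaleR_minus1_left scaleR_one)
qed

lemma normal_eq_or_minus:
  assumes c: "c \<in> \<A>" and y: "y \<in> coords c" and \<nu>: "unit_normal c F (param c y) \<nu>"
  shows "normal (param c y) = \<nu> \<or> normal (param c y) = - \<nu>"
  using unit_normal_eq_or_minus[OF c param_in[OF c y] \<nu> unit_normal_normal[OF c param_in[OF c y]]] .

lemma norm_normal: "p \<in> M \<Longrightarrow> norm (normal p) = 1"
  using unit_normal_normal chart_at by (metis unit_normal_def)

text \<open>Near each point the chosen normal agrees up to sign with a continuous local field.\<close>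

lemma continuous_even_in_normal:
  fixes Q :: "'a \<Rightarrow> 'a \<Rightarrow> real"
  assumes Q: "continuous_on UNIV (\<lambda>z. Q (fst z) (snd z))" and even: "\<And>x \<nu>. Q x (- \<nu>) = Q x \<nu>"
  shows "continuous_on M (\<lambda>p. Q (F p) (normal p))"
  unfolding continuous_on_def
proof
  fix p assume "p \<in> M"
  then obtain c where c: "c \<in> \<A>" "p \<in> fst c" by (rule chart_at)
  note lim = tendsto_chart[OF c]
  obtain N N' where N: "\<forall>\<^sub>F y in nhds (snd c p). y \<in> coords c \<and> unit_normal c F (param c y) (N y)"
    and N': "(N has_derivative N') (at (snd c p))" and Np: "N (snd c p) = normal p"
    using local_unit_normal_field[OF c unit_normal_normal[OF c]] by blast
  have "isCont N (snd c p)" using has_derivative_continuous[OF N'] .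
  from isCont_tendsto_compose[OF this lim(1)]
  have 1: "((\<lambda>q. N (snd c q)) \<longlongrightarrow> normal p) (at p within M)" by (simp add: Np)
  have "isCont (local_map c) (snd c p)"
    using has_derivative_continuous[OF D[OF c(1) snd_in_coords[OF c]]] .
  from isCont_tendsto_compose[OF this lim(1)]
  have 2: "((\<lambda>q. local_map c (snd c q)) \<longlongrightarrow> F p) (at p within M)"
    by (simp add: local_map_def param_snd[OF c])
  have "isCont (\<lambda>z. Q (fst z) (snd z)) (F p, normal p)"
    using Q by (simp add: continuous_on_eq_continuous_at)
  from isCont_tendsto_compose[OF this tendsto_Pair[OF 2 1]]
  have "((\<lambda>q. Q (local_map c (snd c q)) (N (snd c q))) \<longlongrightarrow> Q (F p) (normal p)) (at p within M)" by simp
  moreover have "\<forall>\<^sub>F q in at p within M. Q (local_map c (snd c q)) (N (snd c q)) = Q (F q) (normal q)"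
    using lim(2) eventually_compose_filterlim[OF N lim(1)]
  proof eventually_elim
    case (elim q)
    hence "normal q = N (snd c q) \<or> normal q = - N (snd c q)"
      using unit_normal_eq_or_minus[OF c(1) elim(1) _ unit_normal_normal[OF c(1) elim(1)]]
      by (simp add: param_snd c(1))
    thus ?case using even param_snd[OF c(1) elim(1)] by (auto simp: local_map_def)
  qed
  ultimately show "((\<lambda>q. Q (F q) (normal q)) \<longlongrightarrow> Q (F p) (normal p)) (at p within M)"
    by (rule Lim_transform_eventually)
qed

lemma continuous_F: "continuous_on M F"
proof -
  have "continuous_on M (\<lambda>p. F p \<bullet> b)" for b
    by (rule continuous_even_in_normal[of "\<lambda>x _. x \<bullet> b"]) (auto intro!: continuous_intros)
  thus ?thesis by (subst continuous_on_componentwise) blast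
qed

lemma tangential_part_in_coords:
  assumes c: "c \<in> \<A>" "p \<in> fst c" and \<nu>: "unit_normal c F p \<nu>"
  obtains w where "x - (x \<bullet> \<nu>) *\<^sub>R \<nu> = D c (snd c p) w"
proof -
  have \<nu>': "\<nu> \<in> (range (D c (snd c p)))\<^sup>\<bottom>" "norm \<nu> = 1"
    using \<nu> unfolding unit_normal_def tangent_space_eq[OF c(1)] by auto
  have "(x - (x \<bullet> \<nu>) *\<^sub>R \<nu>) \<bullet> \<nu> = 0" using \<nu>'(2) by (simp add: inner_diff_left dot_square_norm)
  from mem_range_if_orthogonal_to_normal[OF linear_D[OF c(1) snd_in_coords[OF c]] inj_D[OF c] dim \<nu>' this]
  show thesis using that by blast
qed

section \<open>Vanishing of the mean curvature\<close>

text \<open>Put \<open>f = F \<bullet> \<nu>\<close>, so that the self-expander equation reads \<open>H = - f / 2\<close>. By the Weingarten equations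
the derivative of \<open>f\<close> along the tangential part of the position vector is \<open>- A\<close>, where \<open>A\<close> is the second
fundamental form on that vector. Where \<open>f\<close> is nonzero, the curvature inequality forces
\<open>A * H < 0\<close>, hence \<open>f * A > 0\<close>, and so \<open>f\<^sup>2\<close> strictly increases in the direction pointing inward.
A maximum point of \<open>f\<^sup>2\<close> on a sublevel set can therefore only have \<open>f = 0\<close>.\<close>

lemma support_function_vanishes:
  assumes proper: "properly_immersed M F" and se: "self_expander \<A> F" and \<beta>: "\<beta> > 0"
    and ineq: "\<And>c p \<nu>. c \<in> \<A> \<Longrightarrow> p \<in> fst c \<Longrightarrow> unit_normal c F p \<nu> \<Longrightarrow>
           second_ff_norm_sq c F p * (mean_curvature c F p \<nu>)\<^sup>2
           + 1/2 * (mean_curvature c F p \<nu>)\<^sup>2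
           + \<beta> * scalar_second_ff c F p \<nu> (tangent_part c F p (F p)) (tangent_part c F p (F p))
               * mean_curvature c F p \<nu> \<le> 0"
    and p0: "p0 \<in> M"
  shows "F p0 \<bullet> normal p0 = 0"
proof -
  let ?\<phi> = "\<lambda>p. (F p \<bullet> normal p)\<^sup>2"
  have "continuous_on M ?\<phi>"
    by (rule continuous_even_in_normal[of "\<lambda>x \<nu>. (x \<bullet> \<nu>)\<^sup>2"]) (auto intro!: continuous_intros)
  from maximizer_on_sublevel[OF proper this p0]
  obtain q where q: "q \<in> M" "?\<phi> p0 \<le> ?\<phi> q"
    and max: "\<And>p. p \<in> M \<Longrightarrow> norm (F p) \<le> norm (F q) \<Longrightarrow> ?\<phi> p \<le> ?\<phi> q" by metis
  have "F q \<bullet> normal q = 0"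
  proof (rule ccontr)
    assume ne: "F q \<bullet> normal q \<noteq> 0"
    obtain c where c: "c \<in> \<A>" "q \<in> fst c" using q(1) by (rule chart_at)
    define \<nu> where "\<nu> = normal q"
    define y where "y = snd c q"
    have y: "y \<in> coords c" unfolding y_def by (rule snd_in_coords[OF c])
    have un: "unit_normal c F q \<nu>" unfolding \<nu>_def by (rule unit_normal_normal[OF c])
    have \<nu>\<nu>: "\<nu> \<bullet> \<nu> = 1" using un by (simp add: unit_normal_def dot_square_norm)
    obtain N N' where N: "\<forall>\<^sub>F z in nhds y. z \<in> coords c \<and> unit_normal c F (param c z) (N z)"
      and N': "(N has_derivative N') (at y)" and Ny: "N y = \<nu>"
      using local_unit_normal_field[OF c un] unfolding y_def by blast
    note W = derivative_of_normal_field[OF c N[unfolded y_def] N'[unfolded y_def], folded y_def, unfolded Ny]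
    obtain w where w: "F q - (F q \<bullet> \<nu>) *\<^sub>R \<nu> = D c y w"
      using tangential_part_in_coords[OF c un] unfolding y_def by blast
    define A where "A = D2 c w y w \<bullet> \<nu>"
    have tang: "tangent_part c F q (F q) = D c y w"
      using parts_in_terms_of_normal(1)[OF c un] w by simp
    have sff: "scalar_second_ff c F q \<nu> (tangent_part c F q (F q)) (tangent_part c F q (F q)) = A"
      unfolding tang scalar_second_ff_def y_def second_ff_coords[OF c]
        parts_in_terms_of_normal(2)[OF c un] by (simp add: \<nu>\<nu> A_def y_def)
    have H: "mean_curvature c F q \<nu> = - (1/2) * (F q \<bullet> \<nu>)"
      using se c parts_in_terms_of_normal(2)[OF c un]
      unfolding self_expander_def mean_curvature_def by (simp add: \<nu>\<nu>)
    have "second_ff_norm_sq c F q \<ge> 0" unfolding second_ff_norm_sq_def by (intro sum_nonneg) auto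
    hence "second_ff_norm_sq c F q * (mean_curvature c F q \<nu>)\<^sup>2 \<ge> 0" by simp
    moreover have "(mean_curvature c F q \<nu>)\<^sup>2 > 0" using ne by (simp add: \<nu>_def[symmetric] H)
    ultimately have "\<beta> * A * mean_curvature c F q \<nu> < 0"
      using ineq[OF c un] unfolding sff by linarith
    hence "0 < \<beta> * (A * (F q \<bullet> \<nu>))" by (simp add: H algebra_simps)
    hence pos: "A * (F q \<bullet> \<nu>) > 0" using \<beta> by (simp add: zero_less_mult_iff)
    have G: "(local_map c has_derivative D c y) (at y)" by (rule D[OF c(1) y])
    have Gy: "local_map c y = F q" using param_snd[OF c] by (simp add: local_map_def y_def)
    define f' where "f' h = local_map c y \<bullet> N' h + D c y h \<bullet> N y" for h
    have f': "((\<lambda>z. local_map c z \<bullet> N z) has_derivative f') (at y)"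
      unfolding f'_def by (intro has_derivative_inner G N')
    have "\<nu> \<bullet> D c y w = 0"
      using un by (auto simp: unit_normal_def tangent_space_eq c(1) y_def orthogonal_comp_def orthogonal_def inner_commute)
    hence "f' w = F q \<bullet> N' w" by (simp add: f'_def Gy Ny inner_commute)
    also have "\<dots> = D c y w \<bullet> N' w + (F q \<bullet> \<nu>) * (\<nu> \<bullet> N' w)"
      by (simp add: w[symmetric] inner_diff_left)
    also have "\<dots> = - A" using W(1)[of w] W(2)[of w w] by (simp add: A_def inner_commute)
    finally have f'w: "f' w = - A" .
    define \<psi>' where "\<psi>' h = 2 * (F q \<bullet> \<nu>) * f' h" for h
    have \<psi>: "((\<lambda>z. (local_map c z \<bullet> N z)\<^sup>2) has_derivative \<psi>') (at y)"
    proof -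
      have "\<psi>' = (\<lambda>h. f' h * (2 * (F q \<bullet> \<nu>)))" by (rule ext) (simp add: \<psi>'_def)
      thus ?thesis using has_derivative_power[OF f', of 2] by (simp add: Gy Ny mult_ac)
    qed
    have ev: "\<forall>\<^sub>F z in nhds y. ?\<phi> (param c z) = (local_map c z \<bullet> N z)\<^sup>2"
      using N
    proof eventually_elim
      case (elim z)
      have "normal (param c z) = N z \<or> normal (param c z) = - N z"
        using normal_eq_or_minus[OF c(1)] elim by blast
      thus ?case by (auto simp: local_map_def)
    qed
    have "A \<noteq> 0" using pos by auto
    hence "w \<noteq> 0" using f'w has_derivative_linear[OF f'] linear_0 by force
    hence "D c y w \<noteq> 0"
      using inj_D[OF c] linear_D[OF c(1) y] linear_injective_0 unfolding y_def by blast
    hence "D c y w \<bullet> D c y w > 0" by simp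
    moreover have "F q \<bullet> D c y w = D c y w \<bullet> D c y w + (F q \<bullet> \<nu>) * (\<nu> \<bullet> D c y w)"
      by (simp add: w[symmetric] inner_diff_left)
    ultimately have "F q \<bullet> D c y w > 0" using \<open>\<nu> \<bullet> D c y w = 0\<close> by simp
    from no_inward_increase[OF c max \<psi>[unfolded y_def] ev[unfolded y_def] this[unfolded y_def]]
    have "\<psi>' w \<ge> 0" by simp
    thus False using pos by (simp add: \<psi>'_def f'w mult_ac)
  qed
  thus ?thesis using q(2) by simp
qed

section \<open>Constancy of the normal line\<close>

text \<open>Differentiating \<open>F \<bullet> N = 0\<close> shows that the position vector is in the kernel of the second
fundamental form; by symmetry of that form, the derivative of the normal in the radial direction vanishes.\<close>

lemma normal_parallel_along_rays:
  assumes cone: "\<And>p. p \<in> M \<Longrightarrow> F p \<bullet> normal p = 0"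
    and c: "c \<in> \<A>" "q \<in> fst c"
    and N: "\<forall>\<^sub>F z in nhds (snd c q). z \<in> coords c \<and> unit_normal c F (param c z) (N z)"
    and N': "(N has_derivative N') (at (snd c q))"
    and w: "F q = D c (snd c q) w"
  shows "N' w = 0"
proof -
  define y where "y = snd c q"
  have y: "y \<in> coords c" unfolding y_def by (rule snd_in_coords[OF c])
  have un: "unit_normal c F q (N y)"
    using eventually_nhds_x_imp_x[OF N] param_snd[OF c] by (simp add: y_def)
  note W = derivative_of_normal_field[OF c N N', folded y_def]
  have Gy: "local_map c y = F q" using param_snd[OF c] by (simp add: local_map_def y_def)
  have "((\<lambda>z. local_map c z \<bullet> N z) has_derivative (\<lambda>h. local_map c y \<bullet> N' h + D c y h \<bullet> N y)) (at y)"
    using N' unfolding y_def[symmetric] by (intro has_derivative_inner D[OF c(1) y])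
  moreover have "\<forall>\<^sub>F z in nhds y. local_map c z \<bullet> N z = 0"
    using N unfolding y_def[symmetric]
  proof eventually_elim
    case (elim z)
    have "normal (param c z) = N z \<or> normal (param c z) = - N z"
      using normal_eq_or_minus[OF c(1)] elim by blast
    moreover have "param c z \<in> M" using param_in[OF c(1)] chart_subset[OF c(1)] elim by blast
    ultimately show ?case using cone[of "param c z"] by (auto simp: local_map_def)
  qed
  ultimately have d0: "local_map c y \<bullet> N' v + D c y v \<bullet> N y = 0" for v
    by (rule derivative_zero_if_eventually_const)
  have tan: "D c y v \<bullet> N y = 0" for v
    using un by (auto simp: unit_normal_def tangent_space_eq c(1) y_def orthogonal_comp_def orthogonal_def)
  have "D c y v \<bullet> N' w = 0" for v
  proof -
    have "D c y v \<bullet> N' w = D c y w \<bullet> N' v"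
      using W(2)[of v w] W(2)[of w v] D2_commute[OF c(1) y, of v w] by simp
    thus ?thesis using d0[of v] tan[of v] unfolding Gy w[folded y_def] by simp
  qed
  hence "N' w \<in> (range (D c y))\<^sup>\<bottom>" by (auto simp: orthogonal_comp_def orthogonal_def)
  moreover have "N y \<in> (range (D c y))\<^sup>\<bottom>" "norm (N y) = 1"
    using un by (auto simp: unit_normal_def tangent_space_eq c(1) y_def)
  ultimately have "N' w = (N' w \<bullet> N y) *\<^sub>R N y"
    using unit_normal_spans[OF linear_D[OF c(1) y] inj_D[OF c, folded y_def] dim] by blast
  thus ?thesis using W(1)[of w] by simp
qed

lemma locally_injective:
  assumes c: "c \<in> \<A>" "p \<in> fst c"
  obtains B where "open B" "B \<subseteq> coords c" "snd c p \<in> B" "inj_on (local_map c) B"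
proof -
  obtain r where "r > 0" "ball (snd c p) r \<subseteq> coords c" "inj_on (local_map c) (ball (snd c p) r)"
    using immersion_locally_injective[OF open_coords[OF c(1)] snd_in_coords[OF c] D[OF c(1)]
        continuous_D[OF c(1)] inj_D[OF c]] by blast
  thus thesis using that[of "ball (snd c p) r"] by simp
qed

lemma openin_param_image:
  assumes c: "c \<in> \<A>" and B: "open B" "B \<subseteq> coords c"
  shows "openin (top_of_set M) (param c ` B)"
proof -
  have "openin (top_of_set (coords c)) B" using B by (simp add: openin_open_eq open_coords[OF c])
  hence "openin (top_of_set (fst c)) (param c ` B)"
    using homeomorphism_imp_open_map[OF homeomorphism_symD[OF chart_homeomorphism[OF c]]] by blast
  thus ?thesis using chart_openin[OF c] openin_trans by blast
qed

text \<open>The zero set is compact by properness and discrete because \<open>F\<close> is locally injective.\<close>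

lemma finite_zeros:
  assumes proper: "properly_immersed M F"
  shows "finite {p \<in> M. F p = 0}"
proof -
  let ?Z = "{p \<in> M. F p = 0}"
  have "compact {p \<in> M. F p \<in> {0}}" by (rule proper[unfolded properly_immersed_def, rule_format]) simp
  hence comp: "compact ?Z" by simp
  have "\<exists>O'. open O' \<and> z \<in> O' \<and> O' \<inter> ?Z = {z}" if z: "z \<in> ?Z" for z
  proof -
    obtain c where c: "c \<in> \<A>" "z \<in> fst c" using z chart_at by blast
    obtain B where B: "open B" "B \<subseteq> coords c" "snd c z \<in> B" "inj_on (local_map c) B"
      using locally_injective[OF c] by blast
    obtain O' where O': "open O'" "param c ` B = M \<inter> O'"
      using openin_param_image[OF c(1) B(1,2)] by (auto simp: openin_open)
    have "z \<in> param c ` B" using B(3) param_snd[OF c] by (metis imageI)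
    moreover have "p = z" if p: "p \<in> O' \<inter> ?Z" for p
    proof -
      obtain u where u: "u \<in> B" "p = param c u" using p O'(2) by blast
      have "local_map c u = local_map c (snd c z)"
        using p u z param_snd[OF c] by (simp add: local_map_def)
      hence "u = snd c z" using B(3,4) u(1) by (auto dest: inj_onD)
      thus ?thesis using u param_snd[OF c] by simp
    qed
    ultimately show ?thesis using O' z by (intro exI[of _ O']) auto
  qed
  then obtain U where U: "\<And>z. z \<in> ?Z \<Longrightarrow> open (U z) \<and> z \<in> U z \<and> U z \<inter> ?Z = {z}" by metis
  have "open (U z)" if "z \<in> ?Z" for z using U[OF that] by blast
  moreover have "?Z \<subseteq> (\<Union>z\<in>?Z. U z)" using U by blast
  ultimately obtain C where C: "C \<subseteq> ?Z" "finite C" "?Z \<subseteq> (\<Union>z\<in>C. U z)"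
    by (rule compactE_image[OF comp])
  have "?Z \<subseteq> C"
  proof
    fix z assume z: "z \<in> ?Z"
    then obtain z' where z': "z' \<in> C" "z \<in> U z'" using C(3) by blast
    hence "z \<in> U z' \<inter> ?Z" "z' \<in> ?Z" using z C(1) by auto
    hence "z \<in> {z'}" using U[of z'] by blast
    thus "z \<in> C" using z' by simp
  qed
  thus ?thesis using C(2) finite_subset by blast
qed

text \<open>Let \<open>Q\<close> be an even differentiable function on the ambient space. Along the radial direction \<open>Q\<close> of the
normal is constant while \<open>norm F\<close> grows, so for each \<open>\<epsilon> > 0\<close> the function
\<open>Q (normal p) - \<epsilon> * (F p \<bullet> F p)\<close> can attain its maximum on a sublevel set only at a zero of \<open>F\<close>.
Taking for \<open>Q\<close> a product that is nonnegative on unit vectors and vanishes at the normals of all zeros gives \<open>Q (normal p) = 0\<close>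
everywhere: each normal is parallel to the normal at one of finitely many zeros. By connectedness it is
always the same one.\<close>

lemma normal_constant:
  assumes proper: "properly_immersed M F"
    and cone: "\<And>p. p \<in> M \<Longrightarrow> F p \<bullet> normal p = 0"
  obtains v where "norm v = 1" "\<And>p. p \<in> M \<Longrightarrow> normal p = v \<or> normal p = - v"
proof -
  let ?Z = "{p \<in> M. F p = 0}"
  note finZ = finite_zeros[OF proper]
  define Q where "Q \<nu> = (\<Prod>z\<in>?Z. 1 - (\<nu> \<bullet> normal z)\<^sup>2)" for \<nu>
  have Qcont: "continuous_on UNIV Q" unfolding Q_def by (intro continuous_intros)
  have Qeven: "Q (- \<nu>) = Q \<nu>" for \<nu> by (simp add: Q_def)
  have Qdiff: "\<exists>Q'. (Q has_derivative Q') (at \<nu>)" for \<nu>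
  proof -
    have factor: "((\<lambda>\<nu>. 1 - (\<nu> \<bullet> normal z)\<^sup>2) has_derivative (\<lambda>h. - (2 * (h \<bullet> normal z) * (\<nu> \<bullet> normal z)))) (at \<nu>)" for z
      by (auto intro!: derivative_eq_intros)
    show ?thesis unfolding Q_def by (rule exI, rule has_derivative_prod, rule factor)
  qed
  have Qnonneg: "Q (normal p) \<ge> 0" if "p \<in> M" for p
  proof -
    have "(normal p \<bullet> normal z)\<^sup>2 \<le> 1" if "z \<in> M" for z
      using Cauchy_Schwarz_ineq2[of "normal p" "normal z"] norm_normal[OF \<open>p \<in> M\<close>] norm_normal[OF that]
      by (simp add: abs_square_le_1)
    thus ?thesis unfolding Q_def by (intro prod_nonneg) auto
  qed
  have bound: "\<exists>z\<in>?Z. Q (normal p) - \<epsilon> * (F p \<bullet> F p) \<le> Q (normal z)" if p: "p \<in> M" and \<epsilon>: "\<epsilon> > 0" for p \<epsilon>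
  proof -
    let ?\<phi> = "\<lambda>p. Q (normal p) - \<epsilon> * (F p \<bullet> F p)"
    have "continuous_on M ?\<phi>"
      by (rule continuous_even_in_normal[of "\<lambda>x \<nu>. Q \<nu> - \<epsilon> * (x \<bullet> x)"])
        (auto intro!: continuous_intros continuous_on_compose2[OF Qcont] simp: Qeven)
    from maximizer_on_sublevel[OF proper this p]
    obtain q where q: "q \<in> M" "?\<phi> p \<le> ?\<phi> q"
      and max: "\<And>p. p \<in> M \<Longrightarrow> norm (F p) \<le> norm (F q) \<Longrightarrow> ?\<phi> p \<le> ?\<phi> q" by metis
    have "F q = 0"
    proof (rule ccontr)
      assume ne: "F q \<noteq> 0"
      obtain c where c: "c \<in> \<A>" "q \<in> fst c" using q(1) by (rule chart_at)
      define y where "y = snd c q"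
      have y: "y \<in> coords c" unfolding y_def by (rule snd_in_coords[OF c])
      obtain N N' where N: "\<forall>\<^sub>F z in nhds y. z \<in> coords c \<and> unit_normal c F (param c z) (N z)"
        and N': "(N has_derivative N') (at y)"
        using local_unit_normal_field[OF c unit_normal_normal[OF c]] unfolding y_def by blast
      obtain w where w: "F q = D c y w"
        using tangential_part_in_coords[OF c unit_normal_normal[OF c], of "F q"] cone[OF q(1)]
        unfolding y_def by auto
      have N'w: "N' w = 0"
        by (rule normal_parallel_along_rays[OF cone c N[unfolded y_def] N'[unfolded y_def] w[unfolded y_def]])
      obtain Q' where Q': "(Q has_derivative Q') (at (N y))" using Qdiff by blast
      have G: "(local_map c has_derivative D c y) (at y)" by (rule D[OF c(1) y])
      have Gy: "local_map c y = F q" using param_snd[OF c] by (simp add: local_map_def y_def)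
      define \<psi>' where "\<psi>' h = Q' (N' h) - \<epsilon> * (local_map c y \<bullet> D c y h + D c y h \<bullet> local_map c y)" for h
      have \<psi>: "((\<lambda>z. Q (N z) - \<epsilon> * (local_map c z \<bullet> local_map c z)) has_derivative \<psi>') (at y)"
        unfolding \<psi>'_def
        by (intro has_derivative_diff has_derivative_mult_right has_derivative_inner G
            has_derivative_compose[OF N' Q'])
      have ev: "\<forall>\<^sub>F z in nhds y. ?\<phi> (param c z) = Q (N z) - \<epsilon> * (local_map c z \<bullet> local_map c z)"
        using N
      proof eventually_elim
        case (elim z)
        have "normal (param c z) = N z \<or> normal (param c z) = - N z"
          using normal_eq_or_minus[OF c(1)] elim by blast
        thus ?case by (auto simp: local_map_def Qeven)
      qed
      have pos: "F q \<bullet> D c y w > 0" using ne w by (metis inner_gt_zero_iff)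
      from no_inward_increase[OF c max \<psi>[unfolded y_def] ev[unfolded y_def] this[unfolded y_def]]
      have "\<psi>' w \<ge> 0" by simp
      moreover have "\<psi>' w = - (2 * \<epsilon> * (F q \<bullet> D c y w))"
        using linear_0[OF has_derivative_linear[OF Q']]
        by (simp add: \<psi>'_def N'w Gy inner_commute algebra_simps)
      ultimately show False using pos \<epsilon> by (simp add: mult_le_0_iff)
    qed
    thus ?thesis using q by (intro bexI[of _ q]) auto
  qed
  have Qz: "Q (normal z) = 0" if "z \<in> ?Z" for z
    unfolding Q_def using that finZ norm_normal[of z]
    by (intro prod_zero) (auto intro!: bexI[of _ z] simp: dot_square_norm)
  obtain p0 where p0: "p0 \<in> M" using nonempty by blast
  \<comment> \<open>In particular \<open>F\<close> has a zero.\<close>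
  obtain z0 where z0: "z0 \<in> ?Z" using bound[OF p0, of 1] by auto
  have Q0: "Q (normal p) = 0" if p: "p \<in> M" for p
  proof -
    have le: "Q (normal p) \<le> \<epsilon> * (F p \<bullet> F p)" if "\<epsilon> > 0" for \<epsilon> using bound[OF p that] Qz by fastforce
    have "Q (normal p) \<le> 0 + e" if e: "e > 0" for e
    proof -
      define r where "r = F p \<bullet> F p"
      have r: "r \<ge> 0" by (simp add: r_def)
      have "Q (normal p) \<le> e / (1 + r) * r" using e r by (intro le[folded r_def] divide_pos_pos) auto
      also have "\<dots> \<le> e" using e r by (simp add: divide_simps)
      finally show ?thesis by simp
    qed
    hence "Q (normal p) \<le> 0" by (rule field_le_epsilon)
    thus ?thesis using Qnonneg[OF p] by simp
  qed
  have par: "\<exists>z\<in>?Z. normal p = normal z \<or> normal p = - normal z" if p: "p \<in> M" for p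
  proof -
    obtain z where z: "z \<in> ?Z" "1 - (normal p \<bullet> normal z)\<^sup>2 = 0"
      using Q0[OF p] finZ unfolding Q_def by (auto simp: prod_zero_iff)
    hence "(normal p \<bullet> normal z)\<^sup>2 = 1\<^sup>2" by simp
    hence "normal p \<bullet> normal z = 1 \<or> normal p \<bullet> normal z = -1" unfolding power2_eq_iff .
    moreover have "norm (normal p) = 1" "norm (normal z) = 1" using norm_normal p z by auto
    ultimately have "normal p = normal z \<or> normal p = - normal z"
      using unit_vectors_parallel by blast
    thus ?thesis using z by blast
  qed
  \<comment> \<open>This function is continuous with finite range, hence constantly its value at \<open>z0\<close>, which is 1.\<close>
  let ?h = "\<lambda>p. (normal p \<bullet> normal z0)\<^sup>2"
  have hcont: "continuous_on M ?h"
    by (rule continuous_even_in_normal[of "\<lambda>x \<nu>. (\<nu> \<bullet> normal z0)\<^sup>2"]) (auto intro!: continuous_intros)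
  have "?h ` M \<subseteq> ?h ` ?Z"
  proof
    fix t assume "t \<in> ?h ` M"
    then obtain p where p: "p \<in> M" "t = ?h p" by blast
    obtain z where z: "z \<in> ?Z" "normal p = normal z \<or> normal p = - normal z" using par[OF p(1)] by blast
    hence "?h p = ?h z" by auto
    thus "t \<in> ?h ` ?Z" using p z by blast
  qed
  hence "finite (?h ` M)" using finZ by (meson finite_imageI finite_subset)
  then obtain k where k: "\<And>p. p \<in> M \<Longrightarrow> ?h p = k"
    using continuous_finite_range_constant[OF connected hcont] unfolding constant_on_def by blast
  have z0M: "z0 \<in> M" using z0 by simp
  have "normal p = normal z0 \<or> normal p = - normal z0" if p: "p \<in> M" for p
  proof -
    have "?h p = ?h z0" using k[OF p] k[OF z0M] by simp
    hence "(normal p \<bullet> normal z0)\<^sup>2 = 1\<^sup>2" using norm_normal[OF z0M] by (simp add: dot_square_norm)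
    hence "normal p \<bullet> normal z0 = 1 \<or> normal p \<bullet> normal z0 = -1" unfolding power2_eq_iff .
    thus ?thesis using unit_vectors_parallel norm_normal p z0M by blast
  qed
  thus thesis using that norm_normal[OF z0M] by blast
qed

section \<open>The image is a hyperplane\<close>

text \<open>After identifying the hyperplane with the coordinate space, \<open>F\<close> becomes a locally injective map between
manifolds of equal dimension, hence a local homeomorphism by invariance of domain.\<close>

lemma homeomorphism_onto_hyperplane:
  assumes proper: "properly_immersed M F" and v: "v \<noteq> 0" and plane: "\<And>p. p \<in> M \<Longrightarrow> v \<bullet> F p = 0"
  shows "\<exists>g. homeomorphism M {x. v \<bullet> x = 0} F g"
proof -
  let ?P = "{x. v \<bullet> x = 0}"
  have P: "subspace ?P" by (rule subspace_hyperplane)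
  have "dim ?P = dim (UNIV :: 'm set)" using dim_hyperplane[OF v] dim by simp
  then obtain L :: "'a \<Rightarrow> 'm" and L' where L: "linear L" "linear L'" and im: "L ` ?P = UNIV" "L' ` UNIV = ?P"
    and inv: "\<And>x. x \<in> ?P \<Longrightarrow> L' (L x) = x" "\<And>u. L (L' u) = u"
    by (rule isometries_subspaces[OF P subspace_UNIV]) (rule that, simp_all)
  have Lc: "continuous_on S L" and L'c: "continuous_on T L'" for S T
    using L by (auto intro: linear_continuous_on simp: linear_conv_bounded_linear)
  interpret plh: proper_local_homeo M "\<lambda>p. L (F p)"
  proof
    show "continuous_on M (\<lambda>p. L (F p))" by (rule continuous_on_compose2[OF Lc continuous_F]) auto
    show "compact {p \<in> M. L (F p) \<in> K}" if "compact K" for K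
    proof -
      have "compact (L' ` K)" using that by (rule compact_continuous_image[OF L'c])
      hence "compact {p \<in> M. F p \<in> L' ` K}" by (rule proper[unfolded properly_immersed_def, rule_format])
      moreover have "F p \<in> L' ` K \<longleftrightarrow> L (F p) \<in> K" if "p \<in> M" for p
        using inv(1)[of "F p"] inv(2) plane[OF that] by (auto simp: image_iff) metis
      hence "{p \<in> M. F p \<in> L' ` K} = {p \<in> M. L (F p) \<in> K}" by blast
      ultimately show ?thesis by simp
    qed
    show "\<exists>U g. openin (top_of_set M) U \<and> p \<in> U \<and> open ((\<lambda>p. L (F p)) ` U) \<and>
        homeomorphism U ((\<lambda>p. L (F p)) ` U) (\<lambda>p. L (F p)) g" if p: "p \<in> M" for p
    proof -
      obtain c where c: "c \<in> \<A>" "p \<in> fst c" using p by (rule chart_at)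
      obtain B where B: "open B" "B \<subseteq> coords c" "snd c p \<in> B" "inj_on (local_map c) B"
        using locally_injective[OF c] by blast
      let ?f = "\<lambda>y. L (local_map c y)"
      have inP: "local_map c y \<in> ?P" if "y \<in> B" for y
        using plane[of "param c y"] param_in[OF c(1)] chart_subset[OF c(1)] B(2) that
        by (auto simp: local_map_def)
      have "continuous_on (coords c) (local_map c)"
        using D[OF c(1)] by (meson continuous_at_imp_continuous_on has_derivative_continuous)
      hence fc: "continuous_on B ?f"
        using B(2) by (intro continuous_on_compose2[OF Lc[of UNIV]]) (auto intro: continuous_on_subset)
      have fi: "inj_on ?f B"
      proof (rule inj_onI)
        fix y z assume yz: "y \<in> B" "z \<in> B" "?f y = ?f z"
        hence "local_map c y = local_map c z" using inv(1) inP by metis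
        thus "y = z" using B(4) yz by (auto dest: inj_onD)
      qed
      have fo: "open (?f ` B)" by (rule invariance_of_domain[OF fc B(1) fi])
      obtain h where h: "homeomorphism B (?f ` B) ?f h"
        using invariance_of_domain_homeomorphism[OF B(1) fc _ fi] by auto
      have hp: "homeomorphism (param c ` B) B (snd c) (param c)"
        using chart_homeomorphism[OF c(1)] B(2)
        by (metis homeomorphism_of_subsets homeomorphism_symD image_mono subset_refl homeomorphism_image1
            homeomorphism_image2)
      have fim: "(\<lambda>p. L (F p)) ` (param c ` B) = ?f ` B" by (simp add: image_image local_map_def)
      have "homeomorphism (param c ` B) (?f ` B) (?f \<circ> snd c) (param c \<circ> h)"
        by (rule homeomorphism_compose[OF hp h])
      hence "homeomorphism (param c ` B) (?f ` B) (\<lambda>p. L (F p)) (param c \<circ> h)"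
        by (rule homeomorphism_cong)
          (use B(2) snd_param[OF c(1)] in \<open>auto simp: local_map_def\<close>)
      moreover have "p \<in> param c ` B" using B(3) param_snd[OF c] by (metis imageI)
      ultimately show ?thesis using openin_param_image[OF c(1) B(1,2)] fo fim by metis
    qed
  qed
  obtain k where k: "homeomorphism M UNIV (\<lambda>p. L (F p)) k"
    using plh.homeomorphism_if_connected[OF connected nonempty] by blast
  have "homeomorphism UNIV ?P L' L"
    using im inv Lc L'c by (intro homeomorphismI) auto
  from homeomorphism_compose[OF k this]
  have "homeomorphism M ?P (L' \<circ> (\<lambda>p. L (F p))) (k \<circ> L)" .
  hence "homeomorphism M ?P F (k \<circ> L)"
    by (rule homeomorphism_cong) (use inv(1) plane in auto)
  thus ?thesis by blast
qed

end

theorem theorem1p3: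
  fixes M :: "'p::{t2_space, second_countable_topology} set"
    and \<A> :: "('p, 'm::euclidean_space) chart set"
    and F :: "'p \<Rightarrow> 'a::euclidean_space"
    and a b \<beta> :: real
  assumes "immersed_hypersurface M \<A> F"
    and "complete_hypersurface M F"
    and "properly_immersed M F"
    and "self_expander \<A> F"
    and "0 \<le> a" and "a < 1/2" and "b > 0"
    and "\<forall>c\<in>\<A>. \<forall>p\<in>fst c. \<forall>\<nu>. unit_normal c F p \<nu> \<longrightarrow>
           \<bar>mean_curvature c F p \<nu>\<bar> \<le> a * norm (F p) + b"
    and "\<beta> > 0"
    and "\<forall>c\<in>\<A>. \<forall>p\<in>fst c. \<forall>\<nu>. unit_normal c F p \<nu> \<longrightarrow>
           second_ff_norm_sq c F p * (mean_curvature c F p \<nu>)\<^sup>2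
           + 1/2 * (mean_curvature c F p \<nu>)\<^sup>2
           + \<beta> * scalar_second_ff c F p \<nu> (tangent_part c F p (F p)) (tangent_part c F p (F p))
               * mean_curvature c F p \<nu> \<le> 0"
  shows "\<exists>v g. v \<noteq> 0 \<and> homeomorphism M {x. v \<bullet> x = 0} F g"
proof -
  interpret hypersurface M \<A> F by unfold_locales fact
  have cone: "F p \<bullet> normal p = 0" if "p \<in> M" for p
    by (rule support_function_vanishes[OF assms(3,4,9) _ that]) (use assms(10) in blast)
  obtain v where v: "norm v = 1" "\<And>p. p \<in> M \<Longrightarrow> normal p = v \<or> normal p = - v"
    using normal_constant[OF assms(3) cone] by blast
  have "v \<bullet> F p = 0" if "p \<in> M" for p
    using cone[OF that] v(2)[OF that] by (auto simp: inner_commute)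
  moreover have "v \<noteq> 0" using v(1) by auto
  ultimately show ?thesis using homeomorphism_onto_hyperplane[OF assms(3)] by blast
qed

end
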